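(* Consider the following protocol ("Algorithm 3") for the two-party edge-partition model. Alice and Bob choose a uniformly random permutation $\pi$ of $[n]$ with public randomness and iterate over the vertices in the order of $\pi$. For the current vertex $v$, let $m=\Delta+1$, let $X\subseteq[m]$ be the set of colors already assigned to vertices of $N_A(v)$ (known to Alice) and $Y\subseteq[m]$ the set of colors already assigned to vertices of $N_B(v)$ (known to Bob); they color $v$ with an element of $[m]\setminus(X\cup Y)$ found by the following subroutine ("Algorithm 2"): for $\tilde k=m,\,m/2,\,m/4,\dots,1$ (exponentially decreasing guesses) they (a) choose $S\subseteq[m]$ using public randomness by including each element independently with probability $p=\min\{1,150m/\tilde k^2\}$; (b) Alice sends $|S\cap X|$ and Bob sends $|S\cap Y|$; if $|S\cap X|+|S\cap Y|\ge|S|$ they continue with the next value of $\tilde k$; otherwise (c) they run a deterministic binary search on $T:=S$: while $|T|>1$, split $T$ into two halves $L$ and $R=T\setminus L$, Alice sends $|X\cap L|$ and Bob sends $|Y\cap L|$, and they replace $T$ by $L$ if $|X\cap L|+|Y\cap L|<|L|$ and by $R$ otherwise; the final single element of $T$ lies outside $X\cup Y$ and is returned and assigned to $v$. Then for every input graph, this protocol communicates $O(n)$ bits with probability at least $1-2\exp\!\left(-\frac{n}{9\Delta^2\log^2(\Delta+1)}\right)$.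
   Context: Two-party edge-partition model: the input is an undirected graph $G=(V,E)$ on vertex set $[n]$ with maximum degree $\Delta$; $E$ is partitioned into disjoint sets $E_A$ (Alice's) and $E_B$ (Bob's); both know $n$ and $\Delta$ and share public randomness. $N_A(v)$, $N_B(v)$ denote the neighborhoods of $v$ in $(V,E_A)$ and $(V,E_B)$. Cost is the number of bits communicated; probability is over the public randomness. Logarithms are base 2. *)

theory Defs
  imports "HOL-Probability.Probability" "HOL-Combinatorics.Multiset_Permutations"
begin

definition simple_graph :: "nat \<Rightarrow> nat set set \<Rightarrow> bool" where
  "simple_graph n E \<longleftrightarrow> (\<forall>e\<in>E. e \<subseteq> {1..n} \<and> card e = 2)"

definition neighborhood :: "nat set set \<Rightarrow> nat \<Rightarrow> nat set" where
  "neighborhood E v = {u. {u, v} \<in> E}"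

definition max_degree :: "nat \<Rightarrow> nat set set \<Rightarrow> nat" where
  "max_degree n E = Max ((\<lambda>v. card (neighborhood E v)) ` {1..n})"

text \<open>Messages are numbers from a range \<open>{0..N}\<close> whose bound \<open>N\<close> is known to both parties.
  They are sent in fixed-width binary, with \<open>\<lceil>log 2 (N + 1)\<rceil>\<close> bits.\<close>

definition encode :: "nat \<Rightarrow> nat \<Rightarrow> bool list" where
  "encode N x = map (\<lambda>i. odd (x div 2 ^ i)) [0..<nat \<lceil>log 2 (real N + 1)\<rceil>]"

definition lower_half :: "nat set \<Rightarrow> nat set" where
  "lower_half T = set (take (card T div 2) (sorted_list_of_set T))"

lemma lower_half_subset: "finite T \<Longrightarrow> lower_half T \<subseteq> T"
  unfolding lower_half_def using set_take_subset by fastforce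

lemma card_lower_half: "card (lower_half T) = card T div 2"
  by (simp add: lower_half_def distinct_card)

text \<open>In each protocol component below, \<open>X\<close> is Alice's and \<open>Y\<close> is Bob's private set. The
  \<open>bool list\<close> in the result is the transcript, i.e. all bits sent by the two parties.\<close>

function binary_search :: "nat set \<Rightarrow> nat set \<Rightarrow> nat set \<Rightarrow> nat \<times> bool list" where
  "binary_search X Y T =
     (if card T \<le> 1 then (the_elem T, [])
      else
        let L = lower_half T;
            a = card (X \<inter> L);
            b = card (Y \<inter> L);
            (c, tr) = binary_search X Y (if a + b < card L then L else T - L)
        in (c, encode (card L) a @ encode (card L) b @ tr))"
  by auto
termination
proof (relation "Wellfounded.measure (\<lambda>(X, Y, T). card T)", goal_cases)
  case 1
  show ?case by simp
next
  case (2 X Y T L a b)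
  then have fin: "finite T"
    by (metis card.infinite zero_le_one)
  have "card (T - L) = card T - card L"
    using fin "2"(2) lower_half_subset[of T] by (metis card_Diff_subset finite_subset)
  then show ?case
    using 2 by (simp add: card_lower_half)
qed

declare binary_search.simps [simp del]

definition random_subset :: "real \<Rightarrow> nat set \<Rightarrow> nat set pmf" where
  "random_subset p A = map_pmf (\<lambda>f. {x \<in> A. f x}) (Pi_pmf A False (\<lambda>_. bernoulli_pmf p))"

text \<open>The guesses \<open>m, m/2, m/4, \<dots>, 1\<close>; if \<open>m\<close> is not a power of two, the first value
  below 1 is replaced by 1.\<close>

definition guesses :: "nat \<Rightarrow> real list" where
  "guesses m = map (\<lambda>i. max 1 (real m / 2 ^ i)) [0..<Suc (nat \<lceil>log 2 (real m)\<rceil>)]"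

text \<open>The result \<open>None\<close> means that all guesses failed. If \<open>card X + card Y < m\<close>, this does not
  happen, since the guess 1 has sampling probability 1.\<close>

primrec try_guesses ::
    "nat \<Rightarrow> nat set \<Rightarrow> nat set \<Rightarrow> real list \<Rightarrow> (nat option \<times> bool list) pmf" where
  "try_guesses m X Y [] = return_pmf (None, [])"
| "try_guesses m X Y (k # ks) =
     do {
       S \<leftarrow> random_subset (min 1 (150 * real m / k\<^sup>2)) {1..m};
       let a = card (S \<inter> X);
       let b = card (S \<inter> Y);
       let msgs = encode (card S) a @ encode (card S) b;
       if a + b \<ge> card S
       then map_pmf (\<lambda>(c, tr). (c, msgs @ tr)) (try_guesses m X Y ks)
       else (case binary_search X Y S of (c, tr) \<Rightarrow> return_pmf (Some c, msgs @ tr))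
     }"

definition color_sample :: "nat \<Rightarrow> nat set \<Rightarrow> nat set \<Rightarrow> (nat option \<times> bool list) pmf" where
  "color_sample m X Y = try_guesses m X Y (guesses m)"

text \<open>A partial coloring maps the uncolored vertices to \<open>None\<close>, so \<open>ran (\<phi> |` U)\<close> is the set of
  colors already assigned to vertices of \<open>U\<close>.\<close>

primrec color_vertices ::
    "nat \<Rightarrow> nat set set \<Rightarrow> nat set set \<Rightarrow> nat list \<Rightarrow> (nat \<rightharpoonup> nat)
      \<Rightarrow> ((nat \<rightharpoonup> nat) \<times> bool list) pmf" where
  "color_vertices m EA EB [] \<phi> = return_pmf (\<phi>, [])"
| "color_vertices m EA EB (v # vs) \<phi> =
     do {
       (c, tr) \<leftarrow> color_sample m (ran (\<phi> |` neighborhood EA v)) (ran (\<phi> |` neighborhood EB v));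
       (\<phi>', tr') \<leftarrow> color_vertices m EA EB vs (\<phi>(v := c));
       return_pmf (\<phi>', tr @ tr')
     }"

text \<open>The permutation of the vertex set is given as the list of vertices in order of processing.\<close>

definition coloring_protocol ::
    "nat \<Rightarrow> nat \<Rightarrow> nat set set \<Rightarrow> nat set set \<Rightarrow> ((nat \<rightharpoonup> nat) \<times> bool list) pmf" where
  "coloring_protocol n \<Delta> EA EB =
     do {
       \<pi> \<leftarrow> pmf_of_set (permutations_of_set {1..n});
       color_vertices (\<Delta> + 1) EA EB \<pi> Map.empty
     }"

definition communication :: "(nat \<rightharpoonup> nat) \<times> bool list \<Rightarrow> nat" where
  "communication r = length (snd r)"

end

theory Submission
  imports Defs
begin

text \<open>
  Fix the processing order. If \<open>j\<close> neighbors of \<open>v\<close> precede \<open>v\<close>, the slack \<open>k = m - j\<close> bounds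
  \<open>m - |X| - |Y|\<close> from below. The round with guess \<open>m / 2^i\<close> uses a sample of expected size \<open>O(4^i)\<close>,
  hence \<open>O(sqrt 2 ^ i)\<close> bits, and fails with probability at most \<open>1/2\<close> as soon as \<open>m / 2^i \<le> k\<close>. So
  \<open>v\<close> costs \<open>O(sqrt (m / k))\<close> bits in expectation, and \<open>O(log^2 m)\<close> bits always. As the rank of \<open>v\<close> among
  its neighbors is uniform, the average over the orders is \<open>O(1)\<close>.

  For the concentration, the vertices are split into \<open>(\<Delta> + 1)^2\<close> classes in which the closed
  neighborhoods are pairwise disjoint; within a class the ranks are independent. Jensen's inequality
  over the classes bounds the moment generating function of the total cost at
  \<open>t = 1 / (2 (\<Delta> + 1)^2 B)\<close>, where \<open>B = O(log^2 m)\<close> is the deterministic bound, and Markov's inequality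
  gives the tail \<open>exp (- \<Omega>(n / (\<Delta>^2 log^2 (\<Delta> + 1))))\<close>. The constants are not optimized.
\<close>

subsection \<open>Random subsets and message lengths\<close>

lemma length_encode_le:
  assumes "N < 2 ^ j"
  shows "length (encode N x) \<le> j"
proof -
  have "real N + 1 = real (N + 1)" by simp
  also have "\<dots> \<le> real (2 ^ j)"
    using assms by (intro of_nat_mono) simp
  finally have "log 2 (real N + 1) \<le> log 2 (2 ^ j)"
    by (subst log_le_cancel_iff) auto
  then show ?thesis
    by (simp add: encode_def nat_le_iff ceiling_le_iff log_nat_power)
qed

text \<open>Each halving lowers the exponent \<open>j\<close> by one and costs two messages of at
  most \<open>j\<close> bits, so the total is a sum of \<open>2 * i\<close> over
  \<open>i \<le> j\<close>.\<close>

lemma length_binary_search_le: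
  assumes "card T \<le> 2 ^ j"
  shows "length (snd (binary_search X Y T)) \<le> 2 * j\<^sup>2"
  using assms
proof (induction j arbitrary: T)
  case 0
  then show ?case by (subst binary_search.simps) simp
next
  case (Suc j)
  show ?case
  proof (cases "card T \<le> 1")
    case True
    then show ?thesis by (subst binary_search.simps) simp
  next
    case False
    then have fin: "finite T" by (metis card.infinite zero_le_one)
    define L where "L = lower_half T"
    define T' where "T' = (if card (X \<inter> L) + card (Y \<inter> L) < card L then L else T - L)"
    have cL: "card L = card T div 2" by (simp add: L_def card_lower_half)
    have "card (T - L) = card T - card L"
      using fin lower_half_subset[of T] unfolding L_def
      by (metis card_Diff_subset finite_subset)
    then have "card T' \<le> 2 ^ j" using Suc.prems cL by (auto simp: T'_def)
    then have IH: "length (snd (binary_search X Y T')) \<le> 2 * j\<^sup>2" by (rule Suc.IH)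
    \<comment> \<open>\<open>card L\<close> can equal \<open>2 ^ j\<close>, and the counts range up
      to \<open>card L\<close>, so \<open>j\<close> bits would not always suffice.\<close>
    have "card L < 2 ^ Suc j" using cL Suc.prems False by simp
    then have enc: "length (encode (card L) x) \<le> Suc j" for x
      by (rule length_encode_le)
    have "length (snd (binary_search X Y T)) =
        length (encode (card L) (card (X \<inter> L))) + length (encode (card L) (card (Y \<inter> L)))
        + length (snd (binary_search X Y T'))"
      using False
      by (subst binary_search.simps) (simp add: Let_def L_def T'_def case_prod_unfold)
    also have "\<dots> \<le> Suc j + Suc j + 2 * j\<^sup>2"
      by (intro add_mono enc IH)
    also have "\<dots> \<le> 2 * (Suc j)\<^sup>2" by (simp add: power2_eq_square)
    finally show ?thesis .
  qed
qed

section \<open>Moments and lower tail of a random sample\<close>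

lemma expectation_bind_pmf:
  fixes h :: "'b \<Rightarrow> real"
  assumes "finite (set_pmf p)" "\<And>x. x \<in> set_pmf p \<Longrightarrow> finite (set_pmf (f x))"
  shows "measure_pmf.expectation (bind_pmf p f) h =
    measure_pmf.expectation p (\<lambda>x. measure_pmf.expectation (f x) h)"
  using assms
  by (simp add: pmf_expectation_bind[where A = "set_pmf p"] integral_measure_pmf[where A = "set_pmf p"])

lemma set_pmf_random_subset: "finite A \<Longrightarrow> set_pmf (random_subset p A) \<subseteq> Pow A"
  by (auto simp: random_subset_def)

lemma finite_set_pmf_random_subset: "finite A \<Longrightarrow> finite (set_pmf (random_subset p A))"
  by (meson finite_Pow_iff finite_subset set_pmf_random_subset)

lemma expectation_exp_sum_random_subset:
  fixes f :: "nat \<Rightarrow> real"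
  assumes "finite A" "0 \<le> p" "p \<le> 1"
  shows "measure_pmf.expectation (random_subset p A) (\<lambda>S. exp (\<Sum>x\<in>S. f x)) =
    (\<Prod>x\<in>A. 1 - p + p * exp (f x))"
proof -
  have eq: "exp (\<Sum>x\<in>{x \<in> A. \<omega> x}. f x) = (\<Prod>x\<in>A. if \<omega> x then exp (f x) else 1)" for \<omega>
    using assms(1) by (simp add: exp_sum prod.inter_filter)
  have "measure_pmf.expectation (random_subset p A) (\<lambda>S. exp (\<Sum>x\<in>S. f x)) =
    measure_pmf.expectation (Pi_pmf A False (\<lambda>_. bernoulli_pmf p))
      (\<lambda>\<omega>. \<Prod>x\<in>A. if \<omega> x then exp (f x) else 1)"
    unfolding random_subset_def by (simp add: eq)
  also have "\<dots> = (\<Prod>x\<in>A. measure_pmf.expectation (bernoulli_pmf p) (\<lambda>b. if b then exp (f x) else 1))"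
    using assms(1) by (intro expectation_prod_Pi_pmf integrable_measure_pmf_finite) auto
  also have "\<dots> = (\<Prod>x\<in>A. 1 - p + p * exp (f x))"
    using assms by (simp add: algebra_simps)
  finally show ?thesis .
qed

lemma expectation_card_random_subset:
  assumes "finite A" "0 \<le> p" "p \<le> 1"
  shows "measure_pmf.expectation (random_subset p A) (\<lambda>S. real (card S)) = p * real (card A)"
proof -
  have eq: "real (card {x \<in> A. \<omega> x}) = (\<Sum>x\<in>A. if \<omega> x then 1 else 0)" for \<omega>
    using assms(1) by (simp add: sum.inter_filter[symmetric])
  have "measure_pmf.expectation (random_subset p A) (\<lambda>S. real (card S)) =
    measure_pmf.expectation (Pi_pmf A False (\<lambda>_. bernoulli_pmf p))
      (\<lambda>\<omega>. \<Sum>x\<in>A. if \<omega> x then 1 else 0)"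
    unfolding random_subset_def by (simp add: eq)
  also have "\<dots> = (\<Sum>x\<in>A. measure_pmf.expectation (Pi_pmf A False (\<lambda>_. bernoulli_pmf p))
      (\<lambda>\<omega>. if \<omega> x then 1 else 0))"
    using assms(1)
    by (intro Bochner_Integration.integral_sum integrable_measure_pmf_finite)
      (auto simp: set_Pi_pmf intro!: finite_PiE_dflt)
  also have "\<dots> = (\<Sum>x\<in>A. p)"
  proof (rule sum.cong)
    fix x assume x: "x \<in> A"
    have "measure_pmf.expectation (Pi_pmf A False (\<lambda>_. bernoulli_pmf p)) (\<lambda>\<omega>. if \<omega> x then 1 else 0) =
      measure_pmf.expectation (map_pmf (\<lambda>\<omega>. \<omega> x) (Pi_pmf A False (\<lambda>_. bernoulli_pmf p)))
        (\<lambda>b. if b then 1 else 0 :: real)"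
      by simp
    also have "\<dots> = p"
      using assms x by (simp add: Pi_pmf_component del: integral_map_pmf)
    finally show "measure_pmf.expectation (Pi_pmf A False (\<lambda>_. bernoulli_pmf p))
        (\<lambda>\<omega>. if \<omega> x then 1 else 0) = p" .
  qed simp
  finally show ?thesis by simp
qed

lemma exp_le_quadratic:
  fixes x :: real
  assumes "\<bar>x\<bar> \<le> 1"
  shows "exp x \<le> 1 + x + x\<^sup>2"
proof (cases "0 \<le> x")
  case True
  then show ?thesis using exp_bound[of x] assms by simp
next
  case False
  define y where "y = - x"
  have y: "0 < y" using False by (simp add: y_def)
  \<comment> \<open>The product equals \<open>1 + y^3\<close>.\<close>
  have "1 \<le> (1 + y) * (1 - y + y\<^sup>2)"
    using y by (simp add: algebra_simps power2_eq_square)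
  also have "\<dots> \<le> exp y * (1 - y + y\<^sup>2)"
  proof (intro mult_right_mono exp_ge_add_one_self)
    have "1 - y + y\<^sup>2 = (y - 1 / 2)\<^sup>2 + 3 / 4" by (simp add: power2_eq_square field_simps)
    then show "0 \<le> 1 - y + y\<^sup>2" by simp
  qed
  finally have "exp (- y) \<le> 1 - y + y\<^sup>2"
    by (simp add: exp_minus field_simps)
  then show ?thesis by (simp add: y_def)
qed

text \<open>A Chernoff bound. Give each element weight 1, minus 1 for each of the sets
  \<open>X\<close> and \<open>Y\<close> that contains it. The weight of the sample is a sum of
  independent terms with mean at least \<open>p * k\<close>, and the event says that it is not
  positive.\<close>

lemma prob_occupied_random_subset_le:
  assumes "finite A" "A \<noteq> {}" "0 \<le> p" "p \<le> 1"
    and slack: "card (A \<inter> X) + card (A \<inter> Y) + k \<le> card A"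
  shows "measure_pmf.prob (random_subset p A) {S. card (S \<inter> X) + card (S \<inter> Y) \<ge> card S}
    \<le> exp (- (p * (real k)\<^sup>2 / (4 * real (card A))))"
proof -
  define w :: "nat \<Rightarrow> real" where "w x = 1 - of_bool (x \<in> X) - of_bool (x \<in> Y)" for x
  \<comment> \<open>This value minimizes \<open>card A * \<theta>^2 - \<theta> * k\<close>, which is
    the final exponent up to the factor \<open>p\<close>; the minimum is
    \<open>- k^2 / (4 * card A)\<close>.\<close>
  define \<theta> where "\<theta> = real k / (2 * real (card A))"
  have cA: "0 < card A" using assms by (simp add: card_gt_0_iff)
  have \<theta>: "0 \<le> \<theta>" "\<theta> \<le> 1" using slack cA by (auto simp: \<theta>_def field_simps)
  have w1: "\<bar>w x\<bar> \<le> 1" for x by (simp add: w_def)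
  have sum_w: "(\<Sum>x\<in>S. w x) = real (card S) - card (S \<inter> X) - card (S \<inter> Y)" if "finite S" for S
    using that by (simp add: w_def sum_subtractf of_bool_def sum.If_cases Int_def)
  let ?M = "random_subset p A"
  let ?B = "{S. card (S \<inter> X) + card (S \<inter> Y) \<ge> card S}"
  have "measure_pmf.prob ?M ?B = measure_pmf.expectation ?M (indicator ?B)"
    by simp
  also have "\<dots> \<le> measure_pmf.expectation ?M (\<lambda>S. exp (\<Sum>x\<in>S. - (\<theta> * w x)))"
  proof (rule integral_mono_AE)
    show "AE S in ?M. indicator ?B S \<le> exp (\<Sum>x\<in>S. - (\<theta> * w x))"
    proof (rule AE_pmfI)
      fix S assume "S \<in> set_pmf ?M"
      then have "finite S" using set_pmf_random_subset[OF assms(1)] assms(1) by (meson PowD finite_subset subsetD)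
      then have "(\<Sum>x\<in>S. - (\<theta> * w x)) = - (\<theta> * (real (card S) - card (S \<inter> X) - card (S \<inter> Y)))"
        by (simp add: sum_w sum_negf flip: sum_distrib_left)
      moreover have "0 \<le> - (\<theta> * (real (card S) - card (S \<inter> X) - card (S \<inter> Y)))" if "S \<in> ?B"
        using that \<theta> by (simp add: mult_nonneg_nonpos)
      ultimately show "indicator ?B S \<le> exp (\<Sum>x\<in>S. - (\<theta> * w x))"
        by (auto simp: indicator_def)
    qed
  qed (auto intro!: integrable_measure_pmf_finite finite_set_pmf_random_subset assms)
  also have "\<dots> = (\<Prod>x\<in>A. 1 - p + p * exp (- (\<theta> * w x)))"
    using assms by (intro expectation_exp_sum_random_subset)
  also have "\<dots> \<le> (\<Prod>x\<in>A. exp (p * (\<theta>\<^sup>2 - \<theta> * w x)))"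
  proof (intro prod_mono conjI)
    fix x
    show "0 \<le> 1 - p + p * exp (- (\<theta> * w x))" using assms by simp
    have "\<bar>\<theta> * w x\<bar> \<le> \<theta>" using w1[of x] \<theta> by (simp add: abs_mult mult_left_le)
    then have "(\<theta> * w x)\<^sup>2 \<le> \<theta>\<^sup>2" "\<bar>- (\<theta> * w x)\<bar> \<le> 1" using \<theta> by (auto simp: abs_le_square_iff[symmetric])
    then have "exp (- (\<theta> * w x)) \<le> 1 + (\<theta>\<^sup>2 - \<theta> * w x)"
      using exp_le_quadratic[of "- (\<theta> * w x)"] by simp
    then have "p * exp (- (\<theta> * w x)) \<le> p * (1 + (\<theta>\<^sup>2 - \<theta> * w x))"
      using assms by (intro mult_left_mono)
    then have "1 - p + p * exp (- (\<theta> * w x)) \<le> 1 + p * (\<theta>\<^sup>2 - \<theta> * w x)"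
      by (simp add: algebra_simps)
    also have "\<dots> \<le> exp (p * (\<theta>\<^sup>2 - \<theta> * w x))" by (rule exp_ge_add_one_self)
    finally show "1 - p + p * exp (- (\<theta> * w x)) \<le> exp (p * (\<theta>\<^sup>2 - \<theta> * w x))" .
  qed
  also have "\<dots> = exp (p * (card A * \<theta>\<^sup>2 - \<theta> * (\<Sum>x\<in>A. w x)))"
    using assms(1) by (simp add: exp_sum[symmetric] sum_distrib_left[symmetric] sum_subtractf)
  also have "\<dots> \<le> exp (p * (card A * \<theta>\<^sup>2 - \<theta> * k))"
  proof -
    have "real k \<le> (\<Sum>x\<in>A. w x)" using slack sum_w[OF assms(1)] by simp
    then show ?thesis using \<theta> assms by (simp add: mult_left_mono)
  qed
  also have "card A * \<theta>\<^sup>2 - \<theta> * k = - ((real k)\<^sup>2 / (4 * real (card A)))"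
    using cA by (simp add: \<theta>_def field_simps power2_eq_square)
  finally show ?thesis by simp
qed

lemma random_subset_1: "finite A \<Longrightarrow> random_subset 1 A = return_pmf A"
proof -
  assume A: "finite A"
  have "bernoulli_pmf 1 = return_pmf True" by (rule pmf_eqI) (simp add: pmf_bernoulli_True split: split_indicator)
  then show ?thesis using A by (simp add: random_subset_def)
qed

text \<open>If the sampling probability is 1, then \<open>S\<close> is all of \<open>{1..m}\<close>
  and the slack \<open>k \<ge> 1\<close> excludes failure. Otherwise the Chernoff exponent
  \<open>p * k^2 / (4 * m)\<close> equals \<open>37.5 * (k / g)^2\<close>, which is at least
  1.\<close>

lemma prob_guess_fails_le:
  fixes g :: real
  assumes slack: "card ({1..m} \<inter> X) + card ({1..m} \<inter> Y) + k \<le> m"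
    and "1 \<le> g" "g \<le> real k"
  shows "measure_pmf.prob (random_subset (min 1 (150 * real m / g\<^sup>2)) {1..m})
    {S. card (S \<inter> X) + card (S \<inter> Y) \<ge> card S} \<le> 1 / 2"
proof (cases "150 * real m / g\<^sup>2 \<ge> 1")
  case True
  then show ?thesis using assms
    by (simp add: random_subset_1 measure_return_pmf)
next
  case False
  have m: "0 < m" using assms by (cases m) auto
  define p where "p = 150 * real m / g\<^sup>2"
  have p: "0 \<le> p" "p \<le> 1" "min 1 p = p" using False by (auto simp: p_def)
  have "measure_pmf.prob (random_subset p {1..m}) {S. card (S \<inter> X) + card (S \<inter> Y) \<ge> card S}
     \<le> exp (- (p * (real k)\<^sup>2 / (4 * real (card {1..m}))))"
    using assms p m by (intro prob_occupied_random_subset_le) auto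
  also have "\<dots> \<le> exp (- 1)"
  proof -
    have "g\<^sup>2 \<le> (real k)\<^sup>2" using assms by (intro power_mono) auto
    then have "2 * g\<^sup>2 \<le> 75 * (real k)\<^sup>2" by (smt (verit) zero_le_power2)
    then have "1 \<le> p * (real k)\<^sup>2 / (4 * real m)"
      using m assms by (simp add: p_def field_simps)
    then show ?thesis by simp
  qed
  also have "\<dots> \<le> 1 / 2"
    using exp_ge_add_one_self[of 1] by (simp add: exp_minus field_simps)
  finally show ?thesis using p(3) by (simp add: p_def)
qed

subsection \<open>Cost of coloring one vertex\<close>

lemma finite_set_pmf_try_guesses: "finite (set_pmf (try_guesses m X Y ks))"
  by (induction ks) (auto simp: Let_def finite_set_pmf_random_subset split: prod.split)

text \<open>The binary search is charged even if the guess fails and the search is not run.\<close>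

definition round_length :: "nat set \<Rightarrow> nat set \<Rightarrow> nat set \<Rightarrow> nat" where
  "round_length X Y S = length (encode (card S) (card (S \<inter> X))) + length (encode (card S) (card (S \<inter> Y)))
    + length (snd (binary_search X Y S))"

lemma length_messages_le:
  assumes "card S \<le> 2 ^ j"
  shows "length (encode (card S) a) + length (encode (card S) b) \<le> 2 * (j + 1)"
proof -
  have "card S < 2 ^ (j + 1)"
    using assms by (rule le_less_trans) simp
  then show ?thesis
    using length_encode_le[of "card S" "j + 1" a] length_encode_le[of "card S" "j + 1" b] by simp
qed

text \<open>The double root is the square of \<open>2 powr (j / 8)\<close>, and
  \<open>2 powr (j / 8) \<ge> 1 + (j / 8) * ln 2 \<ge> (j + 1) / 12\<close> because
  \<open>ln 2 \<ge> 2 / 3\<close>.\<close>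

lemma square_Suc_le_root_power2: "(real j + 1)\<^sup>2 \<le> 144 * sqrt (sqrt (2 ^ j))"
proof -
  have "(real j + 1) / 12 \<le> 1 + real j / 8 * ln 2"
    using mult_left_mono[OF ln2_ge_two_thirds, of "real j / 8"] by simp
  also have "\<dots> \<le> exp (real j / 8 * ln 2)" by (rule exp_ge_add_one_self)
  also have "\<dots> = 2 powr (real j / 8)" by (simp add: powr_def)
  finally have "((real j + 1) / 12)\<^sup>2 \<le> (2 powr (real j / 8))\<^sup>2" by (intro power_mono) auto
  also have "\<dots> = sqrt (sqrt (2 ^ j))"
    by (simp add: powr_half_sqrt[symmetric] powr_powr powr_realpow[symmetric] flip: powr_realpow)
  finally show ?thesis by (simp add: power_divide)
qed

text \<open>The length is polylogarithmic in \<open>card S\<close>. A fourth root is a convenient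
  upper bound: expected sample sizes grow like \<open>4 ^ i\<close>, so the round costs grow with
  ratio \<open>sqrt 2\<close>, slowly enough to be beaten by a failure probability of
  \<open>1 / 2\<close>.\<close>

lemma round_length_le_root: "real (round_length X Y S) \<le> 576 * sqrt (sqrt (real (card S)))"
proof (cases "card S = 0")
  case True
  then show ?thesis by (simp add: round_length_def encode_def binary_search.simps)
next
  case False
  define s where "s = card S"
  define j where "j = nat \<lceil>log 2 (real s)\<rceil>"
  have s: "1 \<le> s" using False by (simp add: s_def)
  have j1: "log 2 (real s) \<le> real j" by (simp add: j_def real_nat_ceiling_ge)
  have "0 \<le> log 2 (real s)" using s by simp
  then have j2: "real j \<le> log 2 (real s) + 1" unfolding j_def by linarith
  have "real s \<le> 2 powr real j" using j1 s by (simp add: log_le_iff)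
  then have "real s \<le> real (2 ^ j)" by (simp add: powr_realpow)
  then have sj: "card S \<le> 2 ^ j" unfolding s_def by (rule of_nat_le_iff[THEN iffD1])
  have "2 powr real j \<le> 2 powr (log 2 (real s) + 1)" using j2 by simp
  then have js: "2 ^ j \<le> 2 * real s" using s by (simp add: powr_realpow powr_add)
  have "round_length X Y S \<le> 2 * (j + 1) + 2 * j\<^sup>2"
    unfolding round_length_def using sj
    by (intro add_mono length_messages_le length_binary_search_le)
  also have "\<dots> \<le> 2 * (j + 1)\<^sup>2" by (simp add: power2_eq_square)
  finally have "real (round_length X Y S) \<le> real (2 * (j + 1)\<^sup>2)" by (rule of_nat_mono)
  also have "\<dots> = 2 * (real j + 1)\<^sup>2" by (simp add: add.commute)
  also have "\<dots> \<le> 288 * sqrt (sqrt (2 ^ j))" using square_Suc_le_root_power2[of j] by simp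
  \<comment> \<open>\<open>2 * s\<close> is relaxed to \<open>16 * s\<close> so that the fourth root
    of the factor is exactly 2.\<close>
  also have "\<dots> \<le> 288 * sqrt (sqrt (16 * real s))" using js by (intro mult_left_mono real_sqrt_le_mono) auto
  also have "\<dots> = 576 * sqrt (sqrt (real s))" by (simp add: real_sqrt_mult)
  finally show ?thesis by (simp add: s_def)
qed

text \<open>A bound that is linear in \<open>s\<close>, calibrated at the scale
  \<open>4 ^ i\<close>, lets the expected sample size alone control the expected length.\<close>

lemma root_le_weighted:
  assumes "0 \<le> (s::real)"
  shows "sqrt (sqrt s) \<le> sqrt 2 ^ i * (1 + s / 4 ^ i)"
proof -
  define y where "y = s / 4 ^ i"
  have y: "0 \<le> y" using assms by (simp add: y_def)
  have "sqrt (sqrt s) = sqrt (sqrt (4 ^ i * y))" by (simp add: y_def)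
  also have "\<dots> = sqrt 2 ^ i * sqrt (sqrt y)" by (simp add: real_sqrt_mult real_sqrt_power)
  also have "sqrt (sqrt y) \<le> 1 + y"
  proof -
    have "y \<le> (1 + y)\<^sup>2" using y by (simp add: power2_eq_square algebra_simps)
    then have "sqrt y \<le> 1 + y" using y by (simp add: real_le_lsqrt)
    also have "\<dots> \<le> (1 + y)\<^sup>2" using y by (simp add: power2_eq_square algebra_simps)
    finally show ?thesis using y by (simp add: real_le_lsqrt)
  qed
  finally show ?thesis by (simp add: y_def)
qed

lemma expectation_round_length_le:
  fixes i m :: nat
  defines "p \<equiv> min 1 (150 * real m / (max 1 (real m / 2 ^ i))\<^sup>2)"
  shows "measure_pmf.expectation (random_subset p {1..m}) (\<lambda>S. real (round_length X Y S))
    \<le> 86976 * sqrt 2 ^ i"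
proof -
  have p: "0 \<le> p" "p \<le> 1" by (auto simp: p_def)
  have pm: "p * real m \<le> 150 * 4 ^ i"
  proof (cases "m = 0")
    case False
    have "(real m / 2 ^ i)\<^sup>2 \<le> (max 1 (real m / 2 ^ i))\<^sup>2" by (intro power_mono) auto
    then have "150 * real m / (max 1 (real m / 2 ^ i))\<^sup>2 \<le> 150 * real m / (real m / 2 ^ i)\<^sup>2"
      using False by (intro divide_left_mono) auto
    also have "\<dots> = 150 * 4 ^ i / real m"
      using False by (simp add: power2_eq_square field_simps flip: power_mult_distrib)
    finally have "p \<le> 150 * 4 ^ i / real m" by (simp add: p_def)
    then show ?thesis using False by (simp add: field_simps)
  qed simp
  let ?M = "random_subset p {1..m}"
  have int: "integrable (measure_pmf ?M) f" for f :: "nat set \<Rightarrow> real"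
    by (intro integrable_measure_pmf_finite finite_set_pmf_random_subset) simp
  have "measure_pmf.expectation ?M (\<lambda>S. real (round_length X Y S))
      \<le> measure_pmf.expectation ?M (\<lambda>S. 576 * sqrt 2 ^ i * (1 + real (card S) / 4 ^ i))"
  proof (rule integral_mono[OF int int])
    fix S
    show "real (round_length X Y S) \<le> 576 * sqrt 2 ^ i * (1 + real (card S) / 4 ^ i)"
      using round_length_le_root[of X Y S] root_le_weighted[of "real (card S)" i] by simp
  qed
  also have "\<dots> = 576 * sqrt 2 ^ i * (1 + p * real m / 4 ^ i)"
    using expectation_card_random_subset[of "{1..m}" p] p int by simp
  \<comment> \<open>By \<open>pm\<close> the bracket is at most \<open>1 + 150\<close>, and
    \<open>576 * 151 = 86976\<close>.\<close>
  also have "\<dots> \<le> 576 * sqrt 2 ^ i * 151"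
    using pm by (intro mult_left_mono) (auto simp: field_simps)
  finally show ?thesis by simp
qed

text \<open>Later rounds draw fresh samples, so their expected cost is weighted by the failure
  probability of the current round.\<close>

lemma expectation_try_guesses_Cons:
  fixes i m :: nat
  defines "g \<equiv> max 1 (real m / 2 ^ i)"
  shows "measure_pmf.expectation (try_guesses m X Y (g # ks)) (\<lambda>r. real (length (snd r)))
    \<le> 86976 * sqrt 2 ^ i
      + measure_pmf.prob (random_subset (min 1 (150 * real m / g\<^sup>2)) {1..m})
          {S. card (S \<inter> X) + card (S \<inter> Y) \<ge> card S}
        * measure_pmf.expectation (try_guesses m X Y ks) (\<lambda>r. real (length (snd r)))"
proof -
  let ?M = "random_subset (min 1 (150 * real m / g\<^sup>2)) {1..m}"
  let ?B = "{S. card (S \<inter> X) + card (S \<inter> Y) \<ge> card S}"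
  let ?V = "measure_pmf.expectation (try_guesses m X Y ks) (\<lambda>r. real (length (snd r)))"
  have int: "integrable (measure_pmf ?M) f" for f :: "nat set \<Rightarrow> real"
    by (intro integrable_measure_pmf_finite finite_set_pmf_random_subset) simp
  have int': "integrable (measure_pmf (try_guesses m X Y ks)) f" for f :: "_ \<Rightarrow> real"
    by (intro integrable_measure_pmf_finite finite_set_pmf_try_guesses)
  have "measure_pmf.expectation (try_guesses m X Y (g # ks)) (\<lambda>r. real (length (snd r)))
    \<le> measure_pmf.expectation ?M (\<lambda>S. real (round_length X Y S) + indicator ?B S * ?V)"
    unfolding try_guesses.simps
  proof (subst expectation_bind_pmf, goal_cases)
    case 3
    show ?case
      by (intro integral_mono int)
        (auto simp: Let_def case_prod_unfold round_length_def int' indicator_def)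
  qed (auto simp: Let_def finite_set_pmf_random_subset finite_set_pmf_try_guesses split: prod.split)
  also have "\<dots> = measure_pmf.expectation ?M (\<lambda>S. real (round_length X Y S)) + measure_pmf.prob ?M ?B * ?V"
    using int by simp
  finally show ?thesis using expectation_round_length_le[of m i X Y] by (simp add: g_def)
qed

text \<open>Until the guess drops to \<open>k\<close>, round costs grow with ratio
  \<open>sqrt 2\<close>; afterwards the chance of reaching a further round halves each time, so the
  terms shrink by \<open>sqrt 2 / 2\<close>. The total has the order of the cost at the turning
  point \<open>i0\<close>, where \<open>2 ^ i0 \<le> 2 * (m / k)\<close>.\<close>

lemma expectation_color_sample_le:
  assumes slack: "card ({1..m} \<inter> X) + card ({1..m} \<inter> Y) + k \<le> m" and k: "1 \<le> k"
  shows "measure_pmf.expectation (color_sample m X Y) (\<lambda>r. real (length (snd r)))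
    \<le> 10 ^ 6 * sqrt (real m / real k)"
proof -
  define c where "c = (86976 :: real)"
  define r where "r = sqrt 2"
  \<comment> \<open>The lower bound yields \<open>3 * r - 1 \<ge> 3\<close> in \<open>early\<close>;
    the upper one yields \<open>1 + 2 * r \<le> 4\<close> in \<open>late\<close> and the final
    constant \<open>7 * c * 17 / 12 \<le> 10 ^ 6\<close>.\<close>
  have r: "4 / 3 \<le> r" "r \<le> 17 / 12"
    unfolding r_def by (rule real_le_rsqrt real_le_lsqrt; simp add: power2_eq_square)+
  define i0 where "i0 = (LEAST i. real m / 2 ^ i \<le> real k)"
  have ex: "\<exists>i. real m / 2 ^ i \<le> real k"
  proof
    have "real m \<le> 2 ^ m" using of_nat_mono[OF less_imp_le[OF less_exp[of m]]] by simp
    moreover have "(2::real) ^ m \<le> 2 ^ m * real k" using k by simp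
    ultimately have "real m \<le> 2 ^ m * real k" by (rule order_trans)
    then show "real m / 2 ^ m \<le> real k" by (simp add: field_simps)
  qed
  have i0: "real m / 2 ^ i0 \<le> real k" unfolding i0_def by (rule LeastI_ex[OF ex])
  \<comment> \<open>By minimality the guess before round \<open>i0\<close> still exceeds
    \<open>k\<close>; for \<open>i0 = 0\<close> the slack gives \<open>k \<le> m\<close>.\<close>
  have i0_le: "2 ^ i0 \<le> 2 * (real m / real k)"
  proof (cases i0)
    case 0
    have "real k \<le> real m" using slack by simp
    then show ?thesis using 0 k by (simp add: field_simps)
  next
    case (Suc i)
    then have "\<not> real m / 2 ^ i \<le> real k" unfolding i0_def by (metis lessI not_less_Least)
    then show ?thesis using Suc k by (simp add: field_simps)
  qed
  define V where "V i N = measure_pmf.expectation (try_guesses m X Y (map (\<lambda>i. max 1 (real m / 2 ^ i)) [i..<N]))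
      (\<lambda>r. real (length (snd r)))" for i N
  define q where "q i = measure_pmf.prob (random_subset (min 1 (150 * real m / (max 1 (real m / 2 ^ i))\<^sup>2)) {1..m})
          {S. card (S \<inter> X) + card (S \<inter> Y) \<ge> card S}" for i
  have V_ge: "0 \<le> V i N" for i N by (simp add: V_def)
  have V_end: "V i N = 0" if "N \<le> i" for i N using that by (simp add: V_def)
  have V_step: "V i N \<le> c * r ^ i + q i * V (Suc i) N" if "i < N" for i N
    unfolding V_def q_def c_def r_def upt_conv_Cons[OF that] list.map
    by (rule expectation_try_guesses_Cons)
  have q1: "q i \<le> 1" for i by (simp add: q_def)
  have q2: "q i \<le> 1 / 2" if "i0 \<le> i" for i
    unfolding q_def
  proof (rule prob_guess_fails_le[OF slack])
    have "real m / 2 ^ i \<le> real m / 2 ^ i0" using that by (intro divide_left_mono) auto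
    then show "max 1 (real m / 2 ^ i) \<le> real k" using i0 k by simp
  qed simp
  \<comment> \<open>The bound is a supersolution of the recursion with factor \<open>1 / 2\<close>;
    the induction runs backwards from the end of the guess list.\<close>
  have late: "V i N \<le> 4 * c * r ^ i" if "i0 \<le> i" for i N
    using that
  proof (induction "N - i" arbitrary: i)
    case 0
    then show ?case using V_end[of N i] r by (simp add: c_def)
  next
    case (Suc d)
    have IH: "V (Suc i) N \<le> 4 * c * r ^ Suc i" using Suc by (intro Suc(1)) auto
    have "V i N \<le> c * r ^ i + q i * V (Suc i) N" using Suc by (intro V_step) auto
    also have "q i * V (Suc i) N \<le> 1 / 2 * (4 * c * r ^ Suc i)"
      using q2[OF Suc.prems] IH V_ge by (intro mult_mono) auto
    also have "c * r ^ i + \<dots> = c * (1 + 2 * r) * r ^ i" by (simp add: algebra_simps)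
    also have "\<dots> \<le> c * 4 * r ^ i" using r by (intro mult_right_mono mult_left_mono) (auto simp: c_def)
    finally show ?case by (simp add: mult_ac)
  qed
  \<comment> \<open>At \<open>i = i0\<close> the bound is the \<open>4 * c * r ^ i0\<close> of
    \<open>late\<close>; going backwards, the change in the subtracted term pays for the cost
    \<open>c * r ^ i\<close> of each round.\<close>
  have early: "V i N \<le> 7 * c * r ^ i0 - 3 * c * r ^ i" if "i \<le> i0" for i N
    using that
  proof (induction "i0 - i" arbitrary: i)
    case 0
    then show ?case using late[of i0 N] by simp
  next
    case (Suc d)
    show ?case
    proof (cases "i < N")
      case True
      have IH: "V (Suc i) N \<le> 7 * c * r ^ i0 - 3 * c * r ^ Suc i" using Suc by (intro Suc(1)) auto
      have "V i N \<le> c * r ^ i + q i * V (Suc i) N" using True by (rule V_step)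
      also have "q i * V (Suc i) N \<le> 1 * V (Suc i) N" using q1 V_ge by (intro mult_right_mono)
      also have "c * r ^ i + \<dots> \<le> 7 * c * r ^ i0 - c * (3 * r - 1) * r ^ i" using IH by (simp add: algebra_simps)
      also have "\<dots> \<le> 7 * c * r ^ i0 - c * 3 * r ^ i"
        using r by (intro diff_left_mono mult_right_mono mult_left_mono) (auto simp: c_def)
      finally show ?thesis by (simp add: mult_ac)
    next
      case False
      have "r ^ i \<le> r ^ i0" using Suc.prems r by (intro power_increasing) auto
      moreover have "0 \<le> r ^ i0" using r by simp
      ultimately show ?thesis using False V_end[of N i] by (simp add: c_def)
    qed
  qed
  have "measure_pmf.expectation (color_sample m X Y) (\<lambda>r. real (length (snd r)))
      = V 0 (Suc (nat \<lceil>log 2 (real m)\<rceil>))"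
    by (simp only: color_sample_def guesses_def V_def)
  also have "\<dots> \<le> 7 * c * r ^ i0" using early[of 0 "Suc (nat \<lceil>log 2 (real m)\<rceil>)"] by (simp add: c_def)
  also have "r ^ i0 = sqrt (2 ^ i0)" by (simp add: r_def real_sqrt_power)
  also have "\<dots> \<le> sqrt (2 * (real m / real k))" using i0_le by simp
  also have "\<dots> = r * sqrt (real m / real k)" by (simp only: real_sqrt_mult r_def)
  also have "7 * c * (r * sqrt (real m / real k)) \<le> 7 * c * (17 / 12 * sqrt (real m / real k))"
    using r by (intro mult_left_mono mult_right_mono) (auto simp: c_def)
  also have "\<dots> \<le> 10 ^ 6 * sqrt (real m / real k)" by (simp add: c_def)
  finally show ?thesis by (simp add: c_def)
qed

section \<open>Worst-case length for one vertex\<close>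

text \<open>With \<open>j\<close> the rounded-up logarithm of \<open>m\<close>, there are at most
  \<open>j + 1\<close> rounds with two messages of at most \<open>j + 1\<close> bits each, and one
  search of at most \<open>2 * j^2\<close> bits.\<close>

definition sample_bound :: "nat \<Rightarrow> nat" where
  "sample_bound m = 4 * (nat \<lceil>log 2 (real m)\<rceil> + 1)\<^sup>2"

text \<open>Every guess pays for its two counts, but the search is run at most once, since it ends
  the recursion.\<close>

lemma length_try_guesses_le:
  assumes "m \<le> 2 ^ j" "r \<in> set_pmf (try_guesses m X Y ks)"
  shows "length (snd r) \<le> 2 * (j + 1) * length ks + 2 * j\<^sup>2"
  using assms(2)
proof (induction ks arbitrary: r)
  case Nil
  then show ?case by simp
next
  case (Cons k ks)
  from Cons.prems obtain S where S: "S \<in> set_pmf (random_subset (min 1 (150 * real m / k\<^sup>2)) {1..m})"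
    and r: "r \<in> set_pmf (let a = card (S \<inter> X);
           b = card (S \<inter> Y);
           msgs = encode (card S) a @ encode (card S) b
       in if a + b \<ge> card S
       then map_pmf (\<lambda>(c, tr). (c, msgs @ tr)) (try_guesses m X Y ks)
       else (case binary_search X Y S of (c, tr) \<Rightarrow> return_pmf (Some c, msgs @ tr)))"
    by auto
  have "card S \<le> card {1..m}" using S set_pmf_random_subset[of "{1..m}"] by (intro card_mono) auto
  then have cS: "card S \<le> 2 ^ j" using assms(1) by simp
  have msg: "length (encode (card S) (card (S \<inter> X))) + length (encode (card S) (card (S \<inter> Y))) \<le> 2 * (j + 1)"
    by (rule length_messages_le[OF cS])
  show ?case
  proof (cases "card (S \<inter> X) + card (S \<inter> Y) \<ge> card S")
    case True
    with r obtain r' where r': "r' \<in> set_pmf (try_guesses m X Y ks)"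
      and "snd r = encode (card S) (card (S \<inter> X)) @ encode (card S) (card (S \<inter> Y)) @ snd r'"
      by (auto simp: Let_def case_prod_unfold)
    then show ?thesis using Cons.IH[OF r'] msg by simp
  next
    case False
    with r have "snd r = encode (card S) (card (S \<inter> X)) @ encode (card S) (card (S \<inter> Y)) @ snd (binary_search X Y S)"
      by (auto simp: Let_def case_prod_unfold)
    then show ?thesis using length_binary_search_le[OF cS, of X Y] msg by simp
  qed
qed

lemma length_color_sample_le:
  assumes "1 \<le> m" "r \<in> set_pmf (color_sample m X Y)"
  shows "length (snd r) \<le> sample_bound m"
proof -
  define j where "j = nat \<lceil>log 2 (real m)\<rceil>"
  have "log 2 (real m) \<le> real j" by (simp add: j_def real_nat_ceiling_ge)
  then have "real m \<le> real (2 ^ j)" using assms(1) by (simp add: log_le_iff powr_realpow)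
  then have "m \<le> 2 ^ j" by (rule of_nat_le_iff[THEN iffD1])
  then have "length (snd r) \<le> 2 * (j + 1) * length (guesses m) + 2 * j\<^sup>2"
    using assms(2) unfolding color_sample_def by (rule length_try_guesses_le)
  also have "length (guesses m) = j + 1" by (simp add: guesses_def j_def)
  also have "2 * (j + 1) * (j + 1) + 2 * j\<^sup>2 \<le> sample_bound m"
    by (simp add: sample_bound_def j_def[symmetric] power2_eq_square)
  finally show ?thesis .
qed

section \<open>Exponential moments for a fixed order\<close>

lemma exp_le_one_plus_double:
  fixes x :: real
  assumes "0 \<le> x" "x \<le> 1"
  shows "exp x \<le> 1 + 2 * x"
  using exp_le_quadratic[of x] mult_left_mono[of x 1 x] assms by (simp add: power2_eq_square)

text \<open>Linearizing \<open>exp\<close> on \<open>[0, 1]\<close> turns a bound on the mean into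
  one on the exponential moment; the factor 2 comes from
  \<open>exp x \<le> 1 + 2 * x\<close>.\<close>

lemma expectation_exp_le:
  fixes f :: "'a \<Rightarrow> real"
  assumes "finite (set_pmf M)" "0 \<le> t"
    and f: "\<And>x. x \<in> set_pmf M \<Longrightarrow> 0 \<le> f x" "\<And>x. x \<in> set_pmf M \<Longrightarrow> t * f x \<le> 1"
    and \<mu>: "measure_pmf.expectation M f \<le> \<mu>"
  shows "measure_pmf.expectation M (\<lambda>x. exp (t * f x)) \<le> exp (2 * t * \<mu>)"
proof -
  have int: "integrable (measure_pmf M) h" for h :: "'a \<Rightarrow> real"
    using assms(1) by (rule integrable_measure_pmf_finite)
  have "measure_pmf.expectation M (\<lambda>x. exp (t * f x)) \<le> measure_pmf.expectation M (\<lambda>x. 1 + 2 * t * f x)"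
    using assms(2) f exp_le_one_plus_double
    by (intro integral_mono_AE int AE_pmfI) (auto simp: mult.assoc)
  also have "\<dots> = 1 + 2 * t * measure_pmf.expectation M f" using int by simp
  also have "\<dots> \<le> 1 + 2 * t * \<mu>" using \<mu> assms(2) by (simp add: mult_left_mono)
  also have "\<dots> \<le> exp (2 * t * \<mu>)" by (rule exp_ge_add_one_self)
  finally show ?thesis .
qed

text \<open>Here \<open>j\<close> is the number of earlier neighbors. The root is small on average
  over \<open>j\<close>; the minimum with the worst case keeps the values bounded, so that
  \<open>exp\<close> can be linearized again when averaging over the orders.\<close>

definition sample_cost :: "nat \<Rightarrow> nat \<Rightarrow> real" where
  "sample_cost m j = min (real (sample_bound m)) (10 ^ 6 * sqrt (real m / real (m - j)))"

lemma finite_set_pmf_color_sample: "finite (set_pmf (color_sample m X Y))"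
  by (simp add: color_sample_def finite_set_pmf_try_guesses)

lemma expectation_color_sample_le_cost:
  assumes "card ({1..m} \<inter> X) + card ({1..m} \<inter> Y) \<le> j" "j < m"
  shows "measure_pmf.expectation (color_sample m X Y) (\<lambda>r. real (length (snd r))) \<le> sample_cost m j"
  unfolding sample_cost_def
proof (rule min.boundedI)
  have "measure_pmf.expectation (color_sample m X Y) (\<lambda>r. real (length (snd r)))
      \<le> measure_pmf.expectation (color_sample m X Y) (\<lambda>r. real (sample_bound m))"
    using assms(2) length_color_sample_le[of m]
    by (intro integral_mono_AE integrable_measure_pmf_finite finite_set_pmf_color_sample AE_pmfI) auto
  then show "measure_pmf.expectation (color_sample m X Y) (\<lambda>r. real (length (snd r))) \<le> real (sample_bound m)"
    by simp
  show "measure_pmf.expectation (color_sample m X Y) (\<lambda>r. real (length (snd r)))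
      \<le> 10 ^ 6 * sqrt (real m / real (m - j))"
    using assms by (intro expectation_color_sample_le) auto
qed

lemma finite_set_pmf_color_vertices: "finite (set_pmf (color_vertices m EA EB vs \<phi>))"
  by (induction vs arbitrary: \<phi>) (auto simp: finite_set_pmf_color_sample)

lemma card_ran_restrict_le:
  assumes "finite (dom \<phi> \<inter> A)"
  shows "card (ran (\<phi> |` A)) \<le> card (dom \<phi> \<inter> A)"
proof -
  have "ran (\<phi> |` A) \<subseteq> (the \<circ> \<phi>) ` (dom \<phi> \<inter> A)"
    by (force simp: ran_def restrict_map_def split: if_splits)
  then show ?thesis using assms by (meson card_image_le card_mono finite_imageI order_trans)
qed

lemma neighborhood_Un: "neighborhood (EA \<union> EB) v = neighborhood EA v \<union> neighborhood EB v"
  by (auto simp: neighborhood_def)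

text \<open>Given the colors so far, the next vertex uses fresh randomness, and its conditional
  exponential moment has a bound that depends on the order alone; so the bounds multiply.
  \<open>U\<close> holds the vertices already processed, some of which \<open>\<phi>\<close> may
  leave uncolored.\<close>

lemma expectation_exp_color_vertices_le:
  fixes t :: real
  assumes "0 \<le> t" "t * real (sample_bound m) \<le> 1" "EA \<inter> EB = {}"
    and deg: "\<And>v. v \<in> set vs \<Longrightarrow> finite (neighborhood (EA \<union> EB) v) \<and> card (neighborhood (EA \<union> EB) v) < m"
    and "distinct vs" "set vs \<inter> U = {}" "dom \<phi> \<subseteq> U"
  shows "measure_pmf.expectation (color_vertices m EA EB vs \<phi>) (\<lambda>r. exp (t * real (communication r)))
    \<le> exp (2 * t * (\<Sum>v\<in>set vs. sample_cost m
          (card (neighborhood (EA \<union> EB) v \<inter> (U \<union> set (takeWhile (\<lambda>u. u \<noteq> v) vs))))))"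
  using deg assms(5-)
proof (induction vs arbitrary: U \<phi>)
  case Nil
  then show ?case by (simp add: communication_def)
next
  case (Cons v vs)
  let ?N = "neighborhood (EA \<union> EB)"
  define X Y where "X = ran (\<phi> |` neighborhood EA v)" and "Y = ran (\<phi> |` neighborhood EB v)"
  let ?C = "color_sample m X Y"
  let ?R = "\<lambda>c. color_vertices m EA EB vs (\<phi>(v := c))"
  define s where "s = (\<Sum>w\<in>set vs. sample_cost m (card (?N w \<inter> (insert v U \<union> set (takeWhile (\<lambda>u. u \<noteq> w) vs)))))"
  have IH: "measure_pmf.expectation (?R c) (\<lambda>r. exp (t * real (communication r))) \<le> exp (2 * t * s)" for c
    unfolding s_def
  proof (rule Cons.IH)
    have "dom \<phi> \<subseteq> U" using Cons.prems by simp
    then show "dom (\<phi>(v := c)) \<subseteq> insert v U" unfolding dom_fun_upd by (auto simp del: domIff)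
  qed (use Cons.prems in auto)
  have fin: "finite (?N v)" "card (?N v) < m" using Cons.prems by auto
  have "card X + card Y \<le> card (dom \<phi> \<inter> neighborhood EA v) + card (dom \<phi> \<inter> neighborhood EB v)"
    using fin unfolding X_def Y_def neighborhood_Un by (intro add_mono card_ran_restrict_le) auto
  \<comment> \<open>As \<open>EA\<close> and \<open>EB\<close> are disjoint, no neighbor is counted
    twice.\<close>
  also have "\<dots> = card (dom \<phi> \<inter> ?N v)"
    using fin assms(3) unfolding neighborhood_Un Int_Un_distrib
    by (intro card_Un_disjoint[symmetric]) (auto simp: neighborhood_def)
  also have "\<dots> \<le> card (?N v \<inter> U)" using fin Cons.prems by (intro card_mono) auto
  finally have XY: "card X + card Y \<le> card (?N v \<inter> U)" .
  have finXY: "finite X" "finite Y"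
    using fin unfolding X_def Y_def neighborhood_Un by (auto intro!: finite_ran)
  have "card ({1..m} \<inter> X) + card ({1..m} \<inter> Y) \<le> card X + card Y"
    using finXY by (intro add_mono card_mono) auto
  then have XY': "card ({1..m} \<inter> X) + card ({1..m} \<inter> Y) \<le> card (?N v \<inter> U)" using XY by simp
  have lt: "card (?N v \<inter> U) < m" using fin card_mono[of "?N v" "?N v \<inter> U"] by simp
  have C: "measure_pmf.expectation ?C (\<lambda>r. exp (t * real (length (snd r)))) \<le> exp (2 * t * sample_cost m (card (?N v \<inter> U)))"
  proof (rule expectation_exp_le[OF finite_set_pmf_color_sample assms(1)])
    fix r assume "r \<in> set_pmf ?C"
    then have "length (snd r) \<le> sample_bound m" using lt by (intro length_color_sample_le) auto
    then have "t * real (length (snd r)) \<le> t * real (sample_bound m)" using assms(1) by (intro mult_left_mono) auto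
    then show "t * real (length (snd r)) \<le> 1" using assms(2) by simp
  qed (use expectation_color_sample_le_cost[OF XY' lt] in auto)
  have int: "integrable (measure_pmf ?C) h" for h :: "_ \<Rightarrow> real"
    by (intro integrable_measure_pmf_finite finite_set_pmf_color_sample)
  have "measure_pmf.expectation (color_vertices m EA EB (v # vs) \<phi>) (\<lambda>r. exp (t * real (communication r)))
    = measure_pmf.expectation ?C (\<lambda>r. measure_pmf.expectation
        (?R (fst r) \<bind> (\<lambda>r'. return_pmf (fst r', snd r @ snd r'))) (\<lambda>r. exp (t * real (communication r))))"
    unfolding color_vertices.simps X_def[symmetric] Y_def[symmetric] case_prod_unfold
    by (rule expectation_bind_pmf) (simp_all add: finite_set_pmf_color_sample finite_set_pmf_color_vertices)
  also have "\<dots> = measure_pmf.expectation ?C (\<lambda>r. exp (t * real (length (snd r))) *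
      measure_pmf.expectation (?R (fst r)) (\<lambda>r. exp (t * real (communication r))))"
    by (subst expectation_bind_pmf)
      (simp_all add: finite_set_pmf_color_vertices communication_def distrib_left exp_add)
  also have "\<dots> \<le> measure_pmf.expectation ?C (\<lambda>r. exp (t * real (length (snd r))) * exp (2 * t * s))"
    using IH by (intro integral_mono int mult_left_mono) simp_all
  also have "\<dots> = measure_pmf.expectation ?C (\<lambda>r. exp (t * real (length (snd r)))) * exp (2 * t * s)"
    by simp
  also have "\<dots> \<le> exp (2 * t * sample_cost m (card (?N v \<inter> U))) * exp (2 * t * s)"
    using C by (intro mult_right_mono) auto
  also have "\<dots> = exp (2 * t * (sample_cost m (card (?N v \<inter> U)) + s))"
    by (simp add: exp_add[symmetric] algebra_simps)
  also have "sample_cost m (card (?N v \<inter> U)) + s =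
      (\<Sum>w\<in>set (v # vs). sample_cost m (card (?N w \<inter> (U \<union> set (takeWhile (\<lambda>u. u \<noteq> w) (v # vs))))))"
  proof -
    \<comment> \<open>For \<open>w\<close> in \<open>vs\<close>, the vertex \<open>v\<close> moves
      from the processed set into the prefix before \<open>w\<close>.\<close>
    have "s = (\<Sum>w\<in>set vs. sample_cost m (card (?N w \<inter> (U \<union> set (takeWhile (\<lambda>u. u \<noteq> w) (v # vs))))))"
      unfolding s_def using Cons.prems by (intro sum.cong refl arg_cong[where f = "sample_cost m"] arg_cong[where f = card]) auto
    then show ?thesis using Cons.prems by simp
  qed
  finally show ?case .
qed

subsection \<open>Ranks in a random permutation\<close>

definition earlier :: "'a list \<Rightarrow> 'a \<Rightarrow> 'a set" where
  "earlier \<pi> v = set (takeWhile (\<lambda>u. u \<noteq> v) \<pi>)"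

lemma notin_earlier [simp]: "v \<notin> earlier \<pi> v"
  unfolding earlier_def by (auto dest: set_takeWhileD)

lemma earlier_map:
  assumes "inj \<tau>"
  shows "earlier (map \<tau> \<pi>) (\<tau> v) = \<tau> ` earlier \<pi> v"
  using assms by (simp add: earlier_def takeWhile_map o_def inj_eq)

text \<open>Listed in the order of \<open>\<pi>\<close>, the elements of \<open>D\<close> have
  \<open>0, 1, ..., card D - 1\<close> predecessors inside \<open>D\<close>, each number once. The
  induction removes the last entry, which does not affect the ranks of the others.\<close>

lemma sum_rank:
  assumes "distinct \<pi>" "D \<subseteq> set \<pi>"
  shows "(\<Sum>w\<in>D. h (card (D \<inter> earlier \<pi> w))) = (\<Sum>j<card D. h j :: real)"
  using assms
proof (induction \<pi> arbitrary: D rule: rev_induct)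
  case Nil
  then show ?case by simp
next
  case (snoc x \<pi>)
  define D' where "D' = D - {x}"
  have D': "D' \<subseteq> set \<pi>" "finite D'" using snoc.prems by (auto simp: D'_def intro: finite_subset)
  have same: "earlier (\<pi> @ [x]) w = earlier \<pi> w" if "w \<in> D'" for w
    using that D' by (subst (1) earlier_def, subst takeWhile_append1[of w]) (auto simp: earlier_def)
  have "x \<notin> earlier \<pi> w" for w
    unfolding earlier_def using snoc.prems by (auto dest: set_takeWhileD)
  then have "D \<inter> earlier (\<pi> @ [x]) w = D' \<inter> earlier \<pi> w" if "w \<in> D'" for w
    using same[OF that] by (auto simp: D'_def)
  then have "(\<Sum>w\<in>D'. h (card (D \<inter> earlier (\<pi> @ [x]) w))) = (\<Sum>w\<in>D'. h (card (D' \<inter> earlier \<pi> w)))"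
    by simp
  also have "\<dots> = (\<Sum>j<card D'. h j)" using snoc.prems D' by (intro snoc.IH) auto
  finally have IH: "(\<Sum>w\<in>D'. h (card (D \<inter> earlier (\<pi> @ [x]) w))) = (\<Sum>j<card D'. h j)" .
  show ?case
  proof (cases "x \<in> D")
    case True
    then have D: "D = insert x D'" "x \<notin> D'" by (auto simp: D'_def)
    have "earlier (\<pi> @ [x]) x = set \<pi>" using snoc.prems by (auto simp: earlier_def takeWhile_append)
    then have "D \<inter> earlier (\<pi> @ [x]) x = D'" using D D' snoc.prems by auto
    moreover have "(\<Sum>w\<in>D. h (card (D \<inter> earlier (\<pi> @ [x]) w))) =
       h (card (D \<inter> earlier (\<pi> @ [x]) x)) + (\<Sum>w\<in>D'. h (card (D \<inter> earlier (\<pi> @ [x]) w)))"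
      using D D'(2) by (subst (1) D(1)) simp
    moreover have "card D = Suc (card D')" using D D'(2) by simp
    ultimately show ?thesis using IH by simp
  next
    case False
    then show ?thesis using IH by (simp add: D'_def)
  qed
qed

lemma sum_permutations_of_set_map:
  assumes "\<tau> permutes V"
  shows "(\<Sum>\<pi>\<in>permutations_of_set V. F (map \<tau> \<pi>)) = (\<Sum>\<pi>\<in>permutations_of_set V. F \<pi>)"
proof -
  have "permutations_of_set V = map \<tau> ` permutations_of_set V"
    using assms by (simp add: permutations_of_set_image_permutes)
  moreover have "inj_on (map \<tau>) (permutations_of_set V)"
    using permutes_inj[OF assms] by (meson inj_mapI inj_on_subset subset_UNIV)
  ultimately show ?thesis by (metis (no_types, lifting) sum.reindex_cong)
qed

text \<open>Swapping \<open>v\<close> with a uniformly random element of its closed neighborhood preserves the uniform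
  distribution, makes the rank of \<open>v\<close> uniform, and does not affect the ranks of vertices with
  a disjoint closed neighborhood.\<close>

lemma sum_prod_rank:
  fixes N :: "'a \<Rightarrow> 'a set" and h :: "nat \<Rightarrow> real"
  assumes "finite V" and N: "\<And>v. v \<in> V \<Longrightarrow> N v \<subseteq> V - {v}"
    and "finite I" "I \<subseteq> V"
    and disj: "\<And>u v. u \<in> I \<Longrightarrow> v \<in> I \<Longrightarrow> u \<noteq> v \<Longrightarrow> insert u (N u) \<inter> insert v (N v) = {}"
  shows "(\<Sum>\<pi>\<in>permutations_of_set V. \<Prod>v\<in>I. h (card (N v \<inter> earlier \<pi> v))) =
    fact (card V) * (\<Prod>v\<in>I. (\<Sum>j\<le>card (N v). h j) / real (card (N v) + 1))"
  using assms(3-)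
proof (induction I rule: finite_induct)
  case empty
  then show ?case using assms(1) by simp
next
  case (insert v I)
  let ?P = "permutations_of_set V"
  define G where "G \<pi> = (\<Prod>u\<in>I. h (card (N u \<inter> earlier \<pi> u)))" for \<pi>
  define F where "F \<pi> = h (card (N v \<inter> earlier \<pi> v)) * G \<pi>" for \<pi>
  define D where "D = insert v (N v)"
  have v: "v \<in> V" using insert.prems by simp
  have finN: "finite (N v)" using N[OF v] assms(1) finite_subset by blast
  have cD: "card D = Suc (card (N v))" using N[OF v] finN unfolding D_def by (subst card_insert_disjoint) auto
  have DV: "D \<subseteq> V" using N[OF v] v by (auto simp: D_def)
  \<comment> \<open>After the swap \<open>v\<close> stands where \<open>w\<close> stood, so the
    number of its earlier neighbors is the rank of \<open>w\<close> within \<open>D\<close>.\<close>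
  have swap: "F (map (Transposition.transpose v w) \<pi>) = h (card (D \<inter> earlier \<pi> w)) * G \<pi>"
    if w: "w \<in> D" for w \<pi>
  proof -
    let ?\<tau> = "Transposition.transpose v w"
    have inj: "inj ?\<tau>" by (simp add: inj_transpose)
    have "earlier (map ?\<tau> \<pi>) v = ?\<tau> ` earlier \<pi> w"
      using earlier_map[OF inj, of \<pi> w] by simp
    then have "N v \<inter> earlier (map ?\<tau> \<pi>) v = ?\<tau> ` (?\<tau> ` N v \<inter> earlier \<pi> w)"
      using inj by (simp add: image_Int image_image)
    moreover have "?\<tau> ` N v \<inter> earlier \<pi> w = D \<inter> earlier \<pi> w"
    proof -
      have "?\<tau> ` N v = D - {w}"
        using w N[OF v] unfolding D_def
        by (auto simp: Transposition.transpose_def image_iff split: if_splits)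
      then show ?thesis using notin_earlier[of w \<pi>] by auto
    qed
    ultimately have 1: "card (N v \<inter> earlier (map ?\<tau> \<pi>) v) = card (D \<inter> earlier \<pi> w)"
      using inj by (simp add: card_image inj_on_subset)
    have "card (N u \<inter> earlier (map ?\<tau> \<pi>) u) = card (N u \<inter> earlier \<pi> u)" if u: "u \<in> I" for u
    proof -
      \<comment> \<open>The closed neighborhood of \<open>u\<close> avoids both \<open>v\<close> and
        \<open>w\<close>, so the swap fixes it pointwise.\<close>
      have "insert u (N u) \<inter> D = {}" unfolding D_def using insert u by (intro insert.prems) auto
      then have fix_N: "?\<tau> x = x" if "x \<in> insert u (N u)" for x
        using that w by (auto simp: Transposition.transpose_def D_def)
      then have "?\<tau> ` N u = N u" "?\<tau> u = u" by (auto simp: image_iff)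
      then have "N u \<inter> earlier (map ?\<tau> \<pi>) u = ?\<tau> ` (N u \<inter> earlier \<pi> u)"
        using earlier_map[OF inj, of \<pi> u] inj by (simp add: image_Int)
      then show ?thesis using inj by (simp add: card_image inj_on_subset)
    qed
    then show ?thesis by (simp add: F_def G_def 1)
  qed
  \<comment> \<open>Each swap permutes the set of orders, so every \<open>w\<close> in
    \<open>D\<close> contributes the same sum; for a fixed order \<open>sum_rank\<close> then
    evaluates the sum over \<open>w\<close>.\<close>
  have "real (card D) * (\<Sum>\<pi>\<in>?P. F \<pi>) = (\<Sum>w\<in>D. \<Sum>\<pi>\<in>?P. F (map (Transposition.transpose v w) \<pi>))"
    using DV v by (simp add: sum_permutations_of_set_map permutes_swap_id subset_iff)
  also have "\<dots> = (\<Sum>\<pi>\<in>?P. (\<Sum>w\<in>D. h (card (D \<inter> earlier \<pi> w))) * G \<pi>)"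
    by (subst sum.swap) (simp add: swap sum_distrib_right)
  also have "\<dots> = (\<Sum>\<pi>\<in>?P. (\<Sum>j<card D. h j) * G \<pi>)"
    using DV by (intro sum.cong refl) (simp add: sum_rank permutations_of_set_def)
  also have "\<dots> = (\<Sum>j<card D. h j) * (\<Sum>\<pi>\<in>?P. G \<pi>)" by (simp add: sum_distrib_left)
  also have "(\<Sum>\<pi>\<in>?P. G \<pi>) = fact (card V) * (\<Prod>v\<in>I. (\<Sum>j\<le>card (N v). h j) / real (card (N v) + 1))"
    unfolding G_def using insert.prems by (intro insert.IH) auto
  finally have "(\<Sum>\<pi>\<in>?P. F \<pi>) = (\<Sum>j\<le>card (N v). h j) / real (card (N v) + 1)
      * (fact (card V) * (\<Prod>v\<in>I. (\<Sum>j\<le>card (N v). h j) / real (card (N v) + 1)))"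
    unfolding cD lessThan_Suc_atMost by (simp add: field_simps)
  then show ?case using insert.hyps by (simp add: F_def G_def)
qed

subsection \<open>Concentration of the total cost\<close>

text \<open>When an element is added, fewer than \<open>q\<close> others conflict with it, so one of
  the \<open>q\<close> colors is still free.\<close>

lemma greedy_coloring:
  assumes "finite V" and sym: "\<And>u v. R u v \<Longrightarrow> R v u"
    and "\<And>v. v \<in> V \<Longrightarrow> card {u \<in> V. u \<noteq> v \<and> R u v} < q"
  shows "\<exists>col :: 'a \<Rightarrow> nat. (\<forall>v\<in>V. col v < q) \<and> (\<forall>u\<in>V. \<forall>v\<in>V. u \<noteq> v \<longrightarrow> R u v \<longrightarrow> col u \<noteq> col v)"
  using assms(1,3)
proof (induction V rule: finite_induct)
  case empty
  then show ?case by simp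
next
  case (insert x V)
  have "card {u \<in> V. u \<noteq> v \<and> R u v} < q" if "v \<in> V" for v
  proof -
    have "card {u \<in> V. u \<noteq> v \<and> R u v} \<le> card {u \<in> insert x V. u \<noteq> v \<and> R u v}"
      using insert.hyps by (intro card_mono) auto
    then show ?thesis using insert.prems[of v] that by simp
  qed
  then have "\<exists>col :: 'a \<Rightarrow> nat. (\<forall>v\<in>V. col v < q) \<and> (\<forall>u\<in>V. \<forall>v\<in>V. u \<noteq> v \<longrightarrow> R u v \<longrightarrow> col u \<noteq> col v)"
    by (rule insert.IH)
  then obtain col :: "'a \<Rightarrow> nat" where col: "\<forall>v\<in>V. col v < q"
    "\<forall>u\<in>V. \<forall>v\<in>V. u \<noteq> v \<longrightarrow> R u v \<longrightarrow> col u \<noteq> col v"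
    by (elim exE conjE)
  define W where "W = {u \<in> insert x V. u \<noteq> x \<and> R u x}"
  have "card (col ` W) \<le> card W" using insert.hyps by (intro card_image_le) (simp add: W_def)
  also have "\<dots> < card {..<q}" using insert.prems[of x] by (simp add: W_def)
  finally have "\<not> {..<q} \<subseteq> col ` W"
    using insert.hyps card_mono[of "col ` W" "{..<q}"] by (auto simp: W_def)
  then obtain c where c: "c < q" "c \<notin> col ` W" by auto
  have "(col(x := c)) u \<noteq> (col(x := c)) v"
    if "u \<in> insert x V" "v \<in> insert x V" "u \<noteq> v" "R u v" for u v
  proof -
    have "v \<in> W" if "u = x" using that \<open>v \<in> insert x V\<close> \<open>u \<noteq> v\<close> sym[OF \<open>R u v\<close>] by (simp add: W_def)
    moreover have "u \<in> W" if "v = x" using that \<open>u \<in> insert x V\<close> \<open>u \<noteq> v\<close> \<open>R u v\<close> by (simp add: W_def)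
    ultimately show ?thesis using that c(2) col(2) by auto
  qed
  moreover have "\<forall>v\<in>insert x V. (col(x := c)) v < q" using c(1) col(1) by simp
  ultimately show ?case by blast
qed

section \<open>Average cost at a uniform rank\<close>

text \<open>The bound \<open>1 / sqrt x \<le> 2 * (sqrt x - sqrt (x - 1))\<close> telescopes. With
  \<open>d + 1\<close> on the right instead of \<open>m\<close>, the mean over a uniform rank in
  \<open>{0..d}\<close> is at most 2 for every degree \<open>d\<close>.\<close>

lemma sum_sqrt_ratio_le:
  assumes "d < m"
  shows "(\<Sum>j\<le>d. sqrt (real m / real (m - j))) \<le> 2 * real (d + 1)"
proof -
  have step: "1 / sqrt x \<le> 2 * (sqrt x - sqrt (x - 1))" if "1 \<le> x" for x :: real
  proof -
    define a b where "a = sqrt x" and "b = sqrt (x - 1)"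
    have ab: "0 < a" "0 \<le> b" "b \<le> a" "a\<^sup>2 = x" "b\<^sup>2 = x - 1" using that by (auto simp: a_def b_def)
    have "1 = (a - b) * (a + b)" using ab by (simp add: power2_eq_square algebra_simps)
    also have "\<dots> \<le> (a - b) * (2 * a)" using ab by (intro mult_left_mono) auto
    finally show ?thesis using ab(1) by (simp add: a_def[symmetric] b_def[symmetric] field_simps)
  qed
  have tele: "(\<Sum>j\<le>d. 1 / sqrt (real (m - j))) \<le> 2 * (sqrt (real m) - sqrt (real (m - Suc d)))"
    using assms
  proof (induction d)
    case 0
    then show ?case using step[of "real m"] by (simp add: of_nat_diff)
  next
    case (Suc d)
    have eq: "real (m - Suc d) - 1 = real (m - Suc (Suc d))" and ge: "1 \<le> real (m - Suc d)"
      using Suc.prems by simp_all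
    have "1 / sqrt (real (m - Suc d)) \<le> 2 * (sqrt (real (m - Suc d)) - sqrt (real (m - Suc (Suc d))))"
      using step[OF ge] unfolding eq .
    moreover have "(\<Sum>j\<le>d. 1 / sqrt (real (m - j))) \<le> 2 * (sqrt (real m) - sqrt (real (m - Suc d)))"
      using Suc by simp
    moreover have "2 * (a - b) + 2 * (b - c) = 2 * (a - c)" for a b c :: real by simp
    ultimately show ?case unfolding sum.atMost_Suc by (metis add_mono add.commute)
  qed
  have "real (m - Suc d) = sqrt (real (m - Suc d) * real (m - Suc d))" by simp
  also have "\<dots> \<le> sqrt (real m * real (m - Suc d))" by (intro real_sqrt_le_mono mult_right_mono) auto
  finally have root: "real (m - Suc d) \<le> sqrt (real m) * sqrt (real (m - Suc d))" by (simp add: real_sqrt_mult)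
  have "(\<Sum>j\<le>d. sqrt (real m / real (m - j))) = sqrt (real m) * (\<Sum>j\<le>d. 1 / sqrt (real (m - j)))"
    by (simp add: sum_distrib_left real_sqrt_divide)
  also have "\<dots> \<le> sqrt (real m) * (2 * (sqrt (real m) - sqrt (real (m - Suc d))))"
    using tele by (intro mult_left_mono) auto
  also have "\<dots> = 2 * (real m - sqrt (real m) * sqrt (real (m - Suc d)))" by (simp add: algebra_simps)
  also have "\<dots> \<le> 2 * real (d + 1)" using root assms by simp
  finally show ?thesis .
qed

lemma sum_sample_cost_le:
  assumes "d < m"
  shows "(\<Sum>j\<le>d. sample_cost m j) \<le> 2 * 10 ^ 6 * real (d + 1)"
proof -
  have "(\<Sum>j\<le>d. sample_cost m j) \<le> (\<Sum>j\<le>d. 10 ^ 6 * sqrt (real m / real (m - j)))"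
    by (intro sum_mono) (simp add: sample_cost_def)
  also have "\<dots> = 10 ^ 6 * (\<Sum>j\<le>d. sqrt (real m / real (m - j)))" by (simp add: sum_distrib_left)
  also have "\<dots> \<le> 10 ^ 6 * (2 * real (d + 1))" using sum_sqrt_ratio_le[OF assms] by (intro mult_left_mono) auto
  finally show ?thesis by simp
qed

lemma sample_cost_nonneg: "0 \<le> sample_cost m j"
  by (simp add: sample_cost_def)

lemma sample_cost_le: "sample_cost m j \<le> real (sample_bound m)"
  by (simp add: sample_cost_def)

text \<open>The mean cost at a uniform rank is at most \<open>2 * 10 ^ 6\<close>, and linearizing
  \<open>exp\<close> doubles it. Subtracting \<open>4 * 10 ^ 6\<close> compensates, so that products
  of such averages stay at most 1.\<close>

lemma average_exp_sample_cost_le: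
  assumes "d < m" "0 \<le> s" "s * real (sample_bound m) \<le> 1"
  shows "(\<Sum>j\<le>d. exp (s * (sample_cost m j - 4 * 10 ^ 6))) / real (d + 1) \<le> 1"
proof -
  have "(\<Sum>j\<le>d. exp (s * sample_cost m j)) \<le> (\<Sum>j\<le>d. 1 + 2 * (s * sample_cost m j))"
  proof (intro sum_mono exp_le_one_plus_double)
    fix j
    show "0 \<le> s * sample_cost m j" using assms(2) sample_cost_nonneg by simp
    have "s * sample_cost m j \<le> s * real (sample_bound m)" using assms(2) sample_cost_le by (intro mult_left_mono)
    then show "s * sample_cost m j \<le> 1" using assms(3) by simp
  qed
  also have "\<dots> = real (d + 1) + 2 * s * (\<Sum>j\<le>d. sample_cost m j)"
    by (simp add: sum.distrib sum_distrib_left mult_ac)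
  also have "\<dots> \<le> real (d + 1) + 2 * s * (2 * 10 ^ 6 * real (d + 1))"
    using assms by (intro add_left_mono mult_left_mono sum_sample_cost_le) auto
  also have "\<dots> = real (d + 1) * (1 + s * (4 * 10 ^ 6))" by (simp add: algebra_simps)
  also have "\<dots> \<le> real (d + 1) * exp (s * (4 * 10 ^ 6))"
    by (intro mult_left_mono exp_ge_add_one_self) auto
  finally have *: "(\<Sum>j\<le>d. exp (s * sample_cost m j)) \<le> real (d + 1) * exp (s * (4 * 10 ^ 6))" .
  have "(\<Sum>j\<le>d. exp (s * (sample_cost m j - 4 * 10 ^ 6))) =
      (\<Sum>j\<le>d. exp (s * sample_cost m j)) / exp (s * (4 * 10 ^ 6))"
    by (simp add: right_diff_distrib exp_diff sum_divide_distrib)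
  also have "\<dots> \<le> real (d + 1)" using * by (simp add: pos_divide_le_eq)
  finally show ?thesis by simp
qed

lemma sum_exp_rank_cost_le:
  fixes N :: "'a \<Rightarrow> 'a set" and t :: real
  assumes V: "finite V" and N: "\<And>v. v \<in> V \<Longrightarrow> N v \<subseteq> V - {v}"
    and sym: "\<And>u v. u \<in> N v \<Longrightarrow> v \<in> N u"
    and deg: "\<And>v. v \<in> V \<Longrightarrow> card (N v) \<le> \<Delta>"
    and t: "0 \<le> t" "2 * t * (real \<Delta> + 1)\<^sup>2 * real (sample_bound (\<Delta> + 1)) \<le> 1"
  shows "(\<Sum>\<pi>\<in>permutations_of_set V. exp (2 * t * (\<Sum>v\<in>V. sample_cost (\<Delta> + 1) (card (N v \<inter> earlier \<pi> v)))))
    \<le> fact (card V) * exp (8 * 10 ^ 6 * t * real (card V))"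
proof -
  define q where "q = (\<Delta> + 1)\<^sup>2"
  \<comment> \<open>Convexity over \<open>q\<close> classes multiplies the exponent by
    \<open>q\<close>; the assumption on \<open>t\<close> keeps the worst-case exponent of one vertex
    at most 1 even so.\<close>
  define s where "s = 2 * t * real q"
  have q: "0 < q" by (simp add: q_def)
  have s: "0 \<le> s" "s * real (sample_bound (\<Delta> + 1)) \<le> 1"
    using t by (simp_all add: s_def q_def add.commute)
  let ?P = "permutations_of_set V"
  have "card {u \<in> V. u \<noteq> v \<and> insert u (N u) \<inter> insert v (N v) \<noteq> {}} < q" if v: "v \<in> V" for v
  proof -
    have card_closed: "card (insert w (N w)) \<le> \<Delta> + 1" "finite (insert w (N w))" if "w \<in> V" for w
    proof -
      show "finite (insert w (N w))" using N[OF that] V by (meson finite_Diff finite_insert finite_subset)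
      then show "card (insert w (N w)) \<le> \<Delta> + 1" using deg[OF that] by (simp add: card_insert_if)
    qed
    have sub: "insert v (N v) \<subseteq> V" using N v by auto
    let ?U = "\<Union>w\<in>insert v (N v). insert w (N w)"
    have finU: "finite ?U" using card_closed(2) sub v by (intro finite_UN_I) auto
    \<comment> \<open>If the closed neighborhoods of \<open>u\<close> and \<open>v\<close> meet in
      \<open>w\<close>, then by symmetry \<open>u\<close> lies in that of \<open>w\<close>. Leaving
      out \<open>v\<close> makes the count strict.\<close>
    have "{u \<in> V. u \<noteq> v \<and> insert u (N u) \<inter> insert v (N v) \<noteq> {}} \<subseteq> ?U - {v}" using sym by blast
    then have "card {u \<in> V. u \<noteq> v \<and> insert u (N u) \<inter> insert v (N v) \<noteq> {}} \<le> card (?U - {v})"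
      using finU by (intro card_mono) auto
    also have "\<dots> < card ?U" using finU by (intro psubset_card_mono) auto
    also have "\<dots> \<le> (\<Sum>w\<in>insert v (N v). card (insert w (N w)))"
      using card_closed(2)[OF v] by (intro card_UN_le)
    also have "\<dots> \<le> card (insert v (N v)) * (\<Delta> + 1)"
      using sub card_closed(1) by (intro order.trans[OF sum_bounded_above[of _ _ "\<Delta> + 1"]]) auto
    also have "\<dots> \<le> (\<Delta> + 1) * (\<Delta> + 1)" using card_closed(1)[OF v] by (intro mult_right_mono) auto
    finally show ?thesis by (simp add: q_def power2_eq_square)
  qed
  then obtain col :: "'a \<Rightarrow> nat" where col: "\<forall>v\<in>V. col v < q"
    "\<forall>u\<in>V. \<forall>v\<in>V. u \<noteq> v \<longrightarrow> insert u (N u) \<inter> insert v (N v) \<noteq> {} \<longrightarrow> col u \<noteq> col v"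
    using greedy_coloring[of V "\<lambda>u v. insert u (N u) \<inter> insert v (N v) \<noteq> {}" q] V by blast
  define I where "I c = {v \<in> V. col v = c}" for c
  define x where "x \<pi> v = sample_cost (\<Delta> + 1) (card (N v \<inter> earlier \<pi> v)) - 4 * 10 ^ 6" for \<pi> v
  have color_class: "(\<Sum>\<pi>\<in>?P. exp (s * (\<Sum>v\<in>I c. x \<pi> v))) \<le> fact (card V)" for c
  proof -
    have fin: "finite (I c)" using V by (simp add: I_def)
    have "(\<Sum>\<pi>\<in>?P. exp (s * (\<Sum>v\<in>I c. x \<pi> v))) =
      (\<Sum>\<pi>\<in>?P. \<Prod>v\<in>I c. exp (s * (sample_cost (\<Delta> + 1) (card (N v \<inter> earlier \<pi> v)) - 4 * 10 ^ 6)))"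
      using fin by (simp add: exp_sum sum_distrib_left x_def)
    also have "\<dots> = fact (card V) * (\<Prod>v\<in>I c.
        (\<Sum>j\<le>card (N v). exp (s * (sample_cost (\<Delta> + 1) j - 4 * 10 ^ 6))) / real (card (N v) + 1))"
    proof (rule sum_prod_rank[where N = N and h = "\<lambda>j. exp (s * (sample_cost (\<Delta> + 1) j - 4 * 10 ^ 6))", OF V N fin])
      fix u v assume "u \<in> I c" "v \<in> I c" "u \<noteq> v"
      then have uv: "u \<in> V" "v \<in> V" "u \<noteq> v" "col u = col v" by (simp_all add: I_def)
      show "insert u (N u) \<inter> insert v (N v) = {}"
      proof (rule ccontr)
        assume "insert u (N u) \<inter> insert v (N v) \<noteq> {}"
        then have "col u \<noteq> col v" by (rule col(2)[rule_format, OF uv(1-3)])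
        then show False using uv(4) by simp
      qed
    qed (auto simp: I_def)
    also have "\<dots> \<le> fact (card V) * 1"
    proof (intro mult_left_mono prod_le_1 conjI)
      fix v assume "v \<in> I c"
      then have "card (N v) < \<Delta> + 1" using deg[of v] by (simp add: I_def)
      then show "(\<Sum>j\<le>card (N v). exp (s * (sample_cost (\<Delta> + 1) j - 4 * 10 ^ 6))) / real (card (N v) + 1) \<le> 1"
        using s by (intro average_exp_sample_cost_le)
    qed (auto intro!: divide_nonneg_nonneg sum_nonneg)
    finally show ?thesis by simp
  qed
  \<comment> \<open>Jensen's inequality decouples the dependent classes at the price of the factor \<open>q\<close> in \<open>s\<close>.\<close>
  have jensen: "exp (2 * t * (\<Sum>v\<in>V. x \<pi> v)) \<le> (\<Sum>c<q. 1 / real q * exp (s * (\<Sum>v\<in>I c. x \<pi> v)))" for \<pi>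
  proof -
    have "(\<Sum>v\<in>V. x \<pi> v) = (\<Sum>c<q. \<Sum>v\<in>I c. x \<pi> v)"
      unfolding I_def using V col by (intro sum.group[symmetric]) auto
    then have "2 * t * (\<Sum>v\<in>V. x \<pi> v) = (\<Sum>c<q. (1 / real q) *\<^sub>R (s * (\<Sum>v\<in>I c. x \<pi> v)))"
      using q by (simp add: s_def sum_distrib_left mult.assoc)
    moreover have "exp (\<Sum>c<q. (1 / real q) *\<^sub>R (s * (\<Sum>v\<in>I c. x \<pi> v)))
        \<le> (\<Sum>c<q. 1 / real q * exp (s * (\<Sum>v\<in>I c. x \<pi> v)))"
      using q by (intro convex_on_sum[where C = UNIV] exp_convex) auto
    ultimately show ?thesis by simp
  qed
  have "(\<Sum>\<pi>\<in>?P. exp (2 * t * (\<Sum>v\<in>V. x \<pi> v)))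
      \<le> (\<Sum>\<pi>\<in>?P. \<Sum>c<q. 1 / real q * exp (s * (\<Sum>v\<in>I c. x \<pi> v)))"
    by (intro sum_mono jensen)
  also have "\<dots> = (\<Sum>c<q. 1 / real q * (\<Sum>\<pi>\<in>?P. exp (s * (\<Sum>v\<in>I c. x \<pi> v))))"
    by (subst sum.swap) (simp add: sum_distrib_left)
  also have "\<dots> \<le> (\<Sum>c<q. 1 / real q * fact (card V))"
    by (intro sum_mono mult_left_mono color_class) auto
  also have "\<dots> = fact (card V)" using q by simp
  finally have main: "(\<Sum>\<pi>\<in>?P. exp (2 * t * (\<Sum>v\<in>V. x \<pi> v))) \<le> fact (card V)" .
  \<comment> \<open>Undoing the centering costs \<open>2 * t * (4 * 10 ^ 6)\<close> in the exponent
    per vertex.\<close>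
  have "(\<Sum>\<pi>\<in>?P. exp (2 * t * (\<Sum>v\<in>V. sample_cost (\<Delta> + 1) (card (N v \<inter> earlier \<pi> v)))))
      = (\<Sum>\<pi>\<in>?P. exp (2 * t * (\<Sum>v\<in>V. x \<pi> v)) * exp (8 * 10 ^ 6 * t * real (card V)))"
    by (simp add: x_def sum_subtractf exp_add[symmetric] algebra_simps)
  also have "\<dots> \<le> fact (card V) * exp (8 * 10 ^ 6 * t * real (card V))"
    using main by (simp add: mult_right_mono flip: sum_distrib_right)
  finally show ?thesis .
qed

section \<open>The whole protocol\<close>

text \<open>This worst case settles \<open>\<Delta> = 0\<close>, where
  \<open>sample_bound 1 = 4\<close>.\<close>

lemma length_color_vertices_le:
  assumes "1 \<le> m" "r \<in> set_pmf (color_vertices m EA EB vs \<phi>)"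
  shows "communication r \<le> sample_bound m * length vs"
  using assms(2)
proof (induction vs arbitrary: r \<phi>)
  case Nil
  then show ?case by (simp add: communication_def)
next
  case (Cons v vs)
  from Cons.prems obtain c tr r' where
    c: "(c, tr) \<in> set_pmf (color_sample m (ran (\<phi> |` neighborhood EA v)) (ran (\<phi> |` neighborhood EB v)))"
    and r': "r' \<in> set_pmf (color_vertices m EA EB vs (\<phi>(v := c)))" and "snd r = tr @ snd r'"
    by fastforce
  then show ?case
    using length_color_sample_le[OF assms(1) c] Cons.IH[OF r'] by (simp add: communication_def)
qed

lemma neighborhood_sym: "u \<in> neighborhood E v \<Longrightarrow> v \<in> neighborhood E u"
  by (simp add: neighborhood_def insert_commute)

lemma neighborhood_subset: "simple_graph n E \<Longrightarrow> neighborhood E v \<subseteq> {1..n} - {v}"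
  by (force simp: simple_graph_def neighborhood_def)

lemma card_neighborhood_le: "v \<in> {1..n} \<Longrightarrow> card (neighborhood E v) \<le> max_degree n E"
  unfolding max_degree_def by (intro Max_ge) auto

lemma finite_set_pmf_coloring_protocol: "finite (set_pmf (coloring_protocol n \<Delta> EA EB))"
  by (simp add: coloring_protocol_def finite_set_pmf_color_vertices)

lemma expectation_exp_communication_le:
  fixes t :: real
  assumes graph: "simple_graph n (EA \<union> EB)" "EA \<inter> EB = {}" "max_degree n (EA \<union> EB) = \<Delta>"
    and t: "0 \<le> t" "2 * t * (real \<Delta> + 1)\<^sup>2 * real (sample_bound (\<Delta> + 1)) \<le> 1"
  shows "measure_pmf.expectation (coloring_protocol n \<Delta> EA EB) (\<lambda>r. exp (t * real (communication r)))
    \<le> exp (8 * 10 ^ 6 * t * real n)"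
proof -
  let ?N = "neighborhood (EA \<union> EB)"
  let ?P = "permutations_of_set {1..n}"
  have P: "finite ?P" "?P \<noteq> {}" "card ?P = fact n" by auto
  have N: "?N v \<subseteq> {1..n} - {v}" for v by (rule neighborhood_subset[OF graph(1)])
  have deg: "card (?N v) \<le> \<Delta>" if "v \<in> {1..n}" for v using card_neighborhood_le[OF that] graph(3) by metis
  have finN: "finite (?N v)" for v using N finite_subset by blast
  \<comment> \<open>The assumption on \<open>t\<close> includes the factor
    \<open>2 * (\<Delta> + 1)^2 \<ge> 1\<close>, so it implies the weaker condition for a single
    vertex.\<close>
  have "1 * (t * real (sample_bound (\<Delta> + 1))) \<le> (2 * (real \<Delta> + 1)\<^sup>2) * (t * real (sample_bound (\<Delta> + 1)))"
  proof (rule mult_right_mono)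
    have "1 \<le> (real \<Delta> + 1)\<^sup>2" by simp
    then show "1 \<le> 2 * (real \<Delta> + 1)\<^sup>2" by linarith
  qed (use t in simp)
  then have tB: "t * real (sample_bound (\<Delta> + 1)) \<le> 1" using t by (simp add: mult_ac)
  have given_order: "measure_pmf.expectation (color_vertices (\<Delta> + 1) EA EB \<pi> Map.empty) (\<lambda>r. exp (t * real (communication r)))
      \<le> exp (2 * t * (\<Sum>v\<in>{1..n}. sample_cost (\<Delta> + 1) (card (?N v \<inter> earlier \<pi> v))))" if "\<pi> \<in> ?P" for \<pi>
  proof -
    have \<pi>: "set \<pi> = {1..n}" "distinct \<pi>" using that by (auto simp: permutations_of_set_def)
    have "finite (?N v) \<and> card (?N v) < \<Delta> + 1" if "v \<in> set \<pi>" for v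
      using that deg[of v] finN \<pi> by simp
    from expectation_exp_color_vertices_le[OF t(1) tB graph(2) this \<pi>(2), of "{}" Map.empty] show ?thesis
      by (simp add: \<pi>(1) earlier_def)
  qed
  have "measure_pmf.expectation (coloring_protocol n \<Delta> EA EB) (\<lambda>r. exp (t * real (communication r))) =
    (\<Sum>\<pi>\<in>?P. measure_pmf.expectation (color_vertices (\<Delta> + 1) EA EB \<pi> Map.empty) (\<lambda>r. exp (t * real (communication r)))) / fact n"
    unfolding coloring_protocol_def using P
    by (subst pmf_expectation_bind_pmf_of_set) (auto simp: finite_set_pmf_color_vertices sum_distrib_left divide_inverse mult_ac)
  also have "\<dots> \<le> (\<Sum>\<pi>\<in>?P. exp (2 * t * (\<Sum>v\<in>{1..n}. sample_cost (\<Delta> + 1) (card (?N v \<inter> earlier \<pi> v))))) / fact n"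
    by (intro divide_right_mono sum_mono given_order) auto
  also have "\<dots> \<le> fact (card {1..n}) * exp (8 * 10 ^ 6 * t * real (card {1..n})) / fact n"
    using N deg t neighborhood_sym
    by (intro divide_right_mono sum_exp_rank_cost_le) auto
  finally show ?thesis by simp
qed

lemma sample_bound_pos: "0 < sample_bound m"
  by (simp add: sample_bound_def)

text \<open>As the logarithm is at least 1, rounding it up and adding 1 at most triples it; and
  \<open>4 * 3^2 = 36\<close>.\<close>

lemma sample_bound_le:
  assumes "2 \<le> m"
  shows "real (sample_bound m) \<le> 36 * (log 2 (real m))\<^sup>2"
proof -
  have 1: "1 \<le> log 2 (real m)" using assms by (simp add: le_log_iff)
  have "real (nat \<lceil>log 2 (real m)\<rceil>) + 1 \<le> 3 * log 2 (real m)" using 1 by linarith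
  then have "(real (nat \<lceil>log 2 (real m)\<rceil>) + 1)\<^sup>2 \<le> (3 * log 2 (real m))\<^sup>2"
    by (rule power_mono) simp
  then show ?thesis by (simp add: sample_bound_def power_mult_distrib add.commute)
qed

text \<open>The case \<open>\<Delta> = 0\<close> is separate because \<open>log 2 1 = 0\<close> puts
  a zero into the denominator of the exponent. Division by zero yields 0 in HOL; read as an infinite
  exponent, the tail asks for certainty.\<close>

theorem theorem4p10:
  "\<exists>C::real. \<forall>(n::nat) (\<Delta>::nat) (EA :: nat set set) (EB :: nat set set).
     n \<ge> 1 \<longrightarrow> simple_graph n (EA \<union> EB) \<longrightarrow> EA \<inter> EB = {} \<longrightarrow> max_degree n (EA \<union> EB) = \<Delta> \<longrightarrow>
       (\<Delta> \<ge> 1 \<longrightarrow>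
          measure_pmf.prob (coloring_protocol n \<Delta> EA EB) {r. real (communication r) \<le> C * real n}
            \<ge> 1 - 2 * exp (- (real n / (9 * (real \<Delta>)\<^sup>2 * (log 2 (real \<Delta> + 1))\<^sup>2)))) \<and>
       (\<Delta> = 0 \<longrightarrow>
          measure_pmf.prob (coloring_protocol n \<Delta> EA EB) {r. real (communication r) \<le> C * real n}
            = 1)"
proof (intro exI[of _ "8 * 10 ^ 6 + 32"] allI impI conjI)
  fix n \<Delta> :: nat and EA EB
  assume graph: "simple_graph n (EA \<union> EB)" "EA \<inter> EB = {}" "max_degree n (EA \<union> EB) = \<Delta>" and \<Delta>: "1 \<le> \<Delta>"
  let ?Q = "coloring_protocol n \<Delta> EA EB"
  \<comment> \<open>The part \<open>8 * 10 ^ 6\<close> cancels the exponential moment; the surplus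
    32 leaves the tail \<open>exp (- (32 * t * n))\<close>.\<close>
  let ?C = "8 * 10 ^ 6 + 32 :: real"
  define l where "l = log 2 (real \<Delta> + 1)"
  have l: "0 < l" using \<Delta> by (simp add: l_def)
  define B where "B = real (sample_bound (\<Delta> + 1))"
  have B: "0 < B" "B \<le> 36 * l\<^sup>2"
    using sample_bound_le[of "\<Delta> + 1"] sample_bound_pos[of "\<Delta> + 1"] \<Delta>
    by (simp_all add: B_def l_def add.commute)
  \<comment> \<open>The largest \<open>t\<close> that
    \<open>expectation_exp_communication_le\<close> admits.\<close>
  define t where "t = 1 / (2 * (real \<Delta> + 1)\<^sup>2 * B)"
  have t: "0 < t" "2 * t * (real \<Delta> + 1)\<^sup>2 * B = 1" using B by (simp_all add: t_def)
  \<comment> \<open>With \<open>B \<le> 36 * l^2\<close> this gives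
    \<open>1 / t \<le> 288 * \<Delta>^2 * l^2\<close>, and \<open>288 = 32 * 9\<close> explains the
    surplus 32.\<close>
  have "(real \<Delta> + 1)\<^sup>2 \<le> (2 * real \<Delta>)\<^sup>2" using \<Delta> by (intro power_mono) auto
  then have "2 * (real \<Delta> + 1)\<^sup>2 * B \<le> 2 * (4 * (real \<Delta>)\<^sup>2) * (36 * l\<^sup>2)"
    using B by (intro mult_mono) (auto simp: power_mult_distrib)
  then have "1 / (2 * (4 * (real \<Delta>)\<^sup>2) * (36 * l\<^sup>2)) \<le> t"
    unfolding t_def using B l \<Delta> by (intro divide_left_mono mult_pos_pos) auto
  then have t_ge: "1 / (9 * (real \<Delta>)\<^sup>2 * l\<^sup>2) \<le> 32 * t" by simp
  have int: "integrable (measure_pmf ?Q) f" for f :: "_ \<Rightarrow> real"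
    by (intro integrable_measure_pmf_finite finite_set_pmf_coloring_protocol)
  have "measure_pmf.prob ?Q {r. \<not> real (communication r) \<le> ?C * real n} =
      measure_pmf.expectation ?Q (indicator {r. \<not> real (communication r) \<le> ?C * real n})"
    by simp
  \<comment> \<open>Markov's inequality for the exponential of \<open>t\<close> times the
    communication.\<close>
  also have "\<dots> \<le> measure_pmf.expectation ?Q (\<lambda>r. exp (t * real (communication r)) / exp (t * (?C * real n)))"
    using t by (intro integral_mono int) (auto simp: indicator_def)
  also have "\<dots> = measure_pmf.expectation ?Q (\<lambda>r. exp (t * real (communication r))) / exp (t * (?C * real n))"
    by simp
  also have "\<dots> \<le> exp (8 * 10 ^ 6 * t * real n) / exp (t * (?C * real n))"
    using t graph unfolding B_def
    by (intro divide_right_mono expectation_exp_communication_le) auto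
  also have "\<dots> = exp (- (32 * t * real n))" by (simp add: exp_diff[symmetric] algebra_simps)
  also have "\<dots> \<le> exp (- (real n / (9 * (real \<Delta>)\<^sup>2 * l\<^sup>2)))"
    using mult_right_mono[OF t_ge, of "real n"] by simp
  also have "\<dots> \<le> 2 * exp (- (real n / (9 * (real \<Delta>)\<^sup>2 * l\<^sup>2)))" by simp
  finally have "measure_pmf.prob ?Q {r. \<not> real (communication r) \<le> ?C * real n}
      \<le> 2 * exp (- (real n / (9 * (real \<Delta>)\<^sup>2 * l\<^sup>2)))" .
  moreover have "measure_pmf.prob ?Q {r. \<not> real (communication r) \<le> ?C * real n} =
      1 - measure_pmf.prob ?Q {r. real (communication r) \<le> ?C * real n}"
    using measure_pmf.prob_compl[where M = ?Q and A = "{r. real (communication r) \<le> ?C * real n}"]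
    by (simp add: Collect_neg_eq Compl_eq_Diff_UNIV)
  ultimately show "1 - 2 * exp (- (real n / (9 * (real \<Delta>)\<^sup>2 * (log 2 (real \<Delta> + 1))\<^sup>2)))
      \<le> measure_pmf.prob ?Q {r. real (communication r) \<le> ?C * real n}"
    by (simp add: l_def)
next
  fix n \<Delta> :: nat and EA EB :: "nat set set"
  assume \<Delta>: "\<Delta> = 0"
  \<comment> \<open>There is a single color, and every run spends at most 4 bits per vertex.\<close>
  have "real (communication r) \<le> (8 * 10 ^ 6 + 32) * real n" if r: "r \<in> set_pmf (coloring_protocol n \<Delta> EA EB)" for r
  proof -
    obtain \<pi> where \<pi>: "\<pi> \<in> permutations_of_set {1..n}" and r: "r \<in> set_pmf (color_vertices (\<Delta> + 1) EA EB \<pi> Map.empty)"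
      using r by (auto simp: coloring_protocol_def)
    have "length \<pi> = n" using \<pi> length_finite_permutations_of_set by fastforce
    then have "communication r \<le> 4 * n" using length_color_vertices_le[OF _ r] \<Delta> by (simp add: sample_bound_def)
    then show ?thesis by simp
  qed
  then show "measure_pmf.prob (coloring_protocol n \<Delta> EA EB) {r. real (communication r) \<le> (8 * 10 ^ 6 + 32) * real n} = 1"
    by (intro measure_pmf.prob_eq_1[THEN iffD2] AE_pmfI) auto
qed

end
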